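(* Let $(L,R,\eta,\epsilon)$ be an adjunction with $L:\mathcal{B}\to\mathcal{A}$, $R:\mathcal{A}\to\mathcal{B}$, let $(L',R',\eta',\epsilon')$ be an adjunction with $L':\mathcal{B}\to\mathcal{A}'$, $R':\mathcal{A}'\to\mathcal{B}$, and let $F:\mathcal{A}\to\mathcal{A}'$ be a functor such that $F\circ L=L'$. Define $\xi:R\to R'F$ by $\xi:=R'F\epsilon\circ\eta'R$ (using $R'L'R=R'FLR$). Then $\xi L:RL\to R'FL=R'L'$ is a morphism of monads (between the monads $(RL,R\epsilon L,\eta)$ and $(R'L',R'\epsilon'L',\eta')$), and $\epsilon'F\circ L'\xi=F\epsilon$. Assume further that: 1. $\mathcal{A}$ has all coequalizers and $F$ preserves them; 2. $R'$ preserves coequalizers of pairs $(fe,f)$ where $f$ is a composition of regular epimorphisms and $e$ is an idempotent morphism; 3. $R'$ preserves regular epimorphisms; 4. the monad $R'L'$ has an augmentation $\gamma':R'L'\to\mathrm{Id}_{\mathcal{B}}$. Then the monad $RL$ is augmented via $\gamma:=\gamma'\circ\xi L:RL\to\mathrm{Id}_{\mathcal{B}}$. Moreover, for every $n\in\mathbb{N}$ there are a functor $\Gamma_{[n]}:\mathcal{B}\to\mathcal{B}_{[n]}$ into the $n$-th category of the adjoint decomposition of $(L,R)$ and a natural transformation $\gamma_{[n]}:RL_{[n]}\Gamma_{[n]}\to\mathrm{Id}_{\mathcal{B}}$ such that $\Gamma_{[0]}=\mathrm{Id}_{\mathcal{B}}$, $\gamma_{[0]}=\gamma$ and, for all $n\geq0$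 and $B\in\mathcal{B}$, $$\Gamma_{[n+1]}B=(\Gamma_{[n]}B,\gamma_{[n]}B)\in\mathcal{B}_{[n+1]},\qquad \gamma_{[n]}\circ U_{[n]}\eta_{[n]}\Gamma_{[n]}=\mathrm{Id}_{\mathrm{Id}_{\mathcal{B}}},\qquad \gamma_{[n+1]}\circ R\pi_{[n,n+1]}\Gamma_{[n+1]}=\gamma_{[n]}.$$ Moreover $U_{[n,n+1]}\circ\Gamma_{[n+1]}=\Gamma_{[n]}$.
   Context: Whiskering of a natural transformation by functors is written $F\alpha$, $\alpha G$. An augmentation for a monad $(M,m:MM\to M,u:\mathrm{Id}\to M)$ is a natural transformation $\gamma:M\to\mathrm{Id}$ with $\gamma\circ u=\mathrm{Id}$ and $\gamma\gamma=\gamma\circ m$, where $\gamma\gamma:MM\to\mathrm{Id}$ is the horizontal composite; the monad is then said to be augmented via $\gamma$. Adjoint decomposition of $(L,R,\eta,\epsilon)$ (when $\mathcal{A}$ has coequalizers, a choice of which is fixed). Define recursively categories $\mathcal{B}_{[n]}$, functors $U_{[n]}:\mathcal{B}_{[n]}\to\mathcal{B}$, adjunctions $(L_{[n]},R_{[n]},\eta_{[n]},\epsilon_{[n]})$ with $R_{[n]}:\mathcal{A}\to\mathcal{B}_{[n]}$ and $U_{[n]}R_{[n]}=R$, and natural transformations $\pi_{[n]}:LU_{[n]}\to L_{[n]}$. For $n=0$: $\mathcal{B}_{[0]}=\mathcal{B}$, $U_{[0]}=\mathrm{Id}$, $(L_{[0]},R_{[0]},\eta_{[0]},\epsilon_{[0]})=(L,R,\eta,\epsilon)$,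 $\pi_{[0]}=\mathrm{Id}_L$. Given stage $n$: - objects of $\mathcal{B}_{[n+1]}$ are pairs $(B_{[n]},b_{[n]})$ with $B_{[n]}\in\mathcal{B}_{[n]}$ and $b_{[n]}:RL_{[n]}B_{[n]}\to U_{[n]}B_{[n]}$ any morphism in $\mathcal{B}$; morphisms $(B_{[n]},b_{[n]})\to(B'_{[n]},b'_{[n]})$ are morphisms $f:B_{[n]}\to B'_{[n]}$ in $\mathcal{B}_{[n]}$ with $U_{[n]}f\circ b_{[n]}=b'_{[n]}\circ RL_{[n]}f$; $U_{[n,n+1]}:\mathcal{B}_{[n+1]}\to\mathcal{B}_{[n]}$ is the forgetful functor and $U_{[n+1]}=U_{[n]}U_{[n,n+1]}$; - $R_{[n+1]}A=(R_{[n]}A,R\epsilon_{[n]}A)$, $R_{[n+1]}f=R_{[n]}f$; - $\pi_{[n,n+1]}B_{[n+1]}:L_{[n]}B_{[n]}\to L_{[n+1]}B_{[n+1]}$ is the coequalizer of $\pi_{[n]}B_{[n]}\circ Lb_{[n]}$ and $\epsilon L_{[n]}B_{[n]}$, both from $LRL_{[n]}B_{[n]}$ to $L_{[n]}B_{[n]}$, where $B_{[n+1]}=(B_{[n]},b_{[n]})$; this gives a natural transformation $\pi_{[n,n+1]}:L_{[n]}U_{[n,n+1]}\to L_{[n+1]}$, and $\pi_{[n+1]}=\pi_{[n,n+1]}\circ\pi_{[n]}U_{[n,n+1]}$; - the unit and counit of $(L_{[n+1]},R_{[n+1]})$ are determined by $U_{[n,n+1]}\eta_{[n+1]}=R_{[n]}\pi_{[n,n+1]}\circ\eta_{[n]}U_{[n,n+1]}$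 and $\epsilon_{[n+1]}\circ\pi_{[n,n+1]}R_{[n+1]}=\epsilon_{[n]}$. *)

theory Defs
  imports Main
begin

section \<open>Categories, functors and natural transformations\<close>

record ('o, 'm) cat =
  Obj :: "'o set"
  Arr :: "'m set"
  Dom :: "'m \<Rightarrow> 'o"
  Cod :: "'m \<Rightarrow> 'o"
  Idn :: "'o \<Rightarrow> 'm"
  Cmp :: "'m \<Rightarrow> 'm \<Rightarrow> 'm"  (infixl \<open>\<cdot>\<index>\<close> 70)

definition hom :: "('o, 'm) cat \<Rightarrow> 'o \<Rightarrow> 'o \<Rightarrow> 'm set" where
  "hom C X Y = {f \<in> Arr C. Dom C f = X \<and> Cod C f = Y}"

locale category =
  fixes C :: "('o, 'm) cat" (structure)
  assumes dom_obj: "f \<in> Arr C \<Longrightarrow> Dom C f \<in> Obj C"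
    and cod_obj: "f \<in> Arr C \<Longrightarrow> Cod C f \<in> Obj C"
    and idn_hom: "X \<in> Obj C \<Longrightarrow> Idn C X \<in> hom C X X"
    and cmp_hom: "f \<in> hom C X Y \<Longrightarrow> g \<in> hom C Y Z \<Longrightarrow> g \<cdot> f \<in> hom C X Z"
    and idn_right: "f \<in> hom C X Y \<Longrightarrow> f \<cdot> Idn C X = f"
    and idn_left: "f \<in> hom C X Y \<Longrightarrow> Idn C Y \<cdot> f = f"
    and cmp_assoc: "f \<in> hom C W X \<Longrightarrow> g \<in> hom C X Y \<Longrightarrow> h \<in> hom C Y Z \<Longrightarrow>
      h \<cdot> (g \<cdot> f) = (h \<cdot> g) \<cdot> f"

record ('o, 'm, 'p, 'n) fctr =
  Fo :: "'o \<Rightarrow> 'p"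
  Fa :: "'m \<Rightarrow> 'n"

locale cfunctor = source: category C + target: category D
  for C :: "('o, 'm) cat" and D :: "('p, 'n) cat" +
  fixes F :: "('o, 'm, 'p, 'n) fctr"
  assumes fo_obj: "X \<in> Obj C \<Longrightarrow> Fo F X \<in> Obj D"
    and fa_hom: "f \<in> hom C X Y \<Longrightarrow> Fa F f \<in> hom D (Fo F X) (Fo F Y)"
    and fa_idn: "X \<in> Obj C \<Longrightarrow> Fa F (Idn C X) = Idn D (Fo F X)"
    and fa_cmp: "f \<in> hom C X Y \<Longrightarrow> g \<in> hom C Y Z \<Longrightarrow>
      Fa F (g \<cdot>\<^bsub>C\<^esub> f) = Fa F g \<cdot>\<^bsub>D\<^esub> Fa F f"

definition id_fctr :: "('o, 'm, 'o, 'm) fctr" where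
  "id_fctr = \<lparr>Fo = (\<lambda>X. X), Fa = (\<lambda>f. f)\<rparr>"

definition comp_fctr ::
  "('p, 'n, 'q, 'k) fctr \<Rightarrow> ('o, 'm, 'p, 'n) fctr \<Rightarrow> ('o, 'm, 'q, 'k) fctr"
  (infixr \<open>\<circ>\<^sub>F\<close> 75) where
  "G \<circ>\<^sub>F F = \<lparr>Fo = (\<lambda>X. Fo G (Fo F X)), Fa = (\<lambda>f. Fa G (Fa F f))\<rparr>"

text \<open>Equality of functors with source \<open>C\<close>; the values of the underlying total maps of HOL
  outside \<open>C\<close> are irrelevant.\<close>

definition fctr_eq ::
  "('o, 'm) cat \<Rightarrow> ('o, 'm, 'p, 'n) fctr \<Rightarrow> ('o, 'm, 'p, 'n) fctr \<Rightarrow> bool" where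
  "fctr_eq C F G \<longleftrightarrow>
     (\<forall>X \<in> Obj C. Fo F X = Fo G X) \<and> (\<forall>f \<in> Arr C. Fa F f = Fa G f)"

locale nat_trans = left: cfunctor C D F + right: cfunctor C D G
  for C :: "('o, 'm) cat" and D :: "('p, 'n) cat"
    and F G :: "('o, 'm, 'p, 'n) fctr" +
  fixes \<tau> :: "'o \<Rightarrow> 'n"
  assumes component_hom: "X \<in> Obj C \<Longrightarrow> \<tau> X \<in> hom D (Fo F X) (Fo G X)"
    and naturality: "f \<in> hom C X Y \<Longrightarrow> \<tau> Y \<cdot>\<^bsub>D\<^esub> Fa F f = Fa G f \<cdot>\<^bsub>D\<^esub> \<tau> X"

definition nat_eq :: "('o, 'm) cat \<Rightarrow> ('o \<Rightarrow> 'n) \<Rightarrow> ('o \<Rightarrow> 'n) \<Rightarrow> bool" where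
  "nat_eq C \<sigma> \<tau> \<longleftrightarrow> (\<forall>X \<in> Obj C. \<sigma> X = \<tau> X)"

definition vcomp :: "('p, 'n) cat \<Rightarrow> ('o \<Rightarrow> 'n) \<Rightarrow> ('o \<Rightarrow> 'n) \<Rightarrow> 'o \<Rightarrow> 'n" where
  "vcomp D \<sigma> \<tau> = (\<lambda>X. \<sigma> X \<cdot>\<^bsub>D\<^esub> \<tau> X)"

definition whisker_left :: "('p, 'n, 'q, 'k) fctr \<Rightarrow> ('o \<Rightarrow> 'n) \<Rightarrow> 'o \<Rightarrow> 'k"
  (infixr \<open>\<rhd>\<close> 80) where
  "F \<rhd> \<alpha> = (\<lambda>X. Fa F (\<alpha> X))"

definition whisker_right :: "('p \<Rightarrow> 'n) \<Rightarrow> ('o, 'm, 'p, 'k) fctr \<Rightarrow> 'o \<Rightarrow> 'n"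
  (infixl \<open>\<lhd>\<close> 80) where
  "\<alpha> \<lhd> G = (\<lambda>X. \<alpha> (Fo G X))"

text \<open>Horizontal composite of \<open>\<alpha> : F \<rightarrow> G\<close> and \<open>\<beta> : H \<rightarrow> K\<close>, where \<open>H\<close> and \<open>K\<close> have target \<open>E\<close>.\<close>

definition hcomp ::
  "('q, 'k) cat \<Rightarrow> ('p, 'n, 'q, 'k) fctr \<Rightarrow> ('o, 'm, 'p, 'n) fctr \<Rightarrow>
    ('p \<Rightarrow> 'k) \<Rightarrow> ('o \<Rightarrow> 'n) \<Rightarrow> 'o \<Rightarrow> 'k" where
  "hcomp E H G \<beta> \<alpha> = vcomp E (\<beta> \<lhd> G) (H \<rhd> \<alpha>)"

definition id_nat :: "('p, 'n) cat \<Rightarrow> ('o, 'm, 'p, 'n) fctr \<Rightarrow> 'o \<Rightarrow> 'n" where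
  "id_nat D F = (\<lambda>X. Idn D (Fo F X))"


section \<open>Adjunctions, monads and augmentations\<close>

locale adjunction =
  L: cfunctor B A L + R: cfunctor A B R +
  unit: nat_trans B B id_fctr "R \<circ>\<^sub>F L" \<eta> +
  counit: nat_trans A A "L \<circ>\<^sub>F R" id_fctr \<epsilon>
  for B :: "('b, 'f) cat" and A :: "('a, 'g) cat"
    and L :: "('b, 'f, 'a, 'g) fctr" and R :: "('a, 'g, 'b, 'f) fctr"
    and \<eta> :: "'b \<Rightarrow> 'f" and \<epsilon> :: "'a \<Rightarrow> 'g" +
  assumes triangle_L: "nat_eq B (vcomp A (\<epsilon> \<lhd> L) (L \<rhd> \<eta>)) (id_nat A L)"
    and triangle_R: "nat_eq A (vcomp B (R \<rhd> \<epsilon>) (\<eta> \<lhd> R)) (id_nat B R)"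

locale monad =
  mult: nat_trans C C "M \<circ>\<^sub>F M" M m + unit: nat_trans C C id_fctr M u
  for C :: "('o, 'm) cat" and M :: "('o, 'm, 'o, 'm) fctr" and m u :: "'o \<Rightarrow> 'm" +
  assumes assoc: "nat_eq C (vcomp C m (M \<rhd> m)) (vcomp C m (m \<lhd> M))"
    and unit_left: "nat_eq C (vcomp C m (u \<lhd> M)) (id_nat C M)"
    and unit_right: "nat_eq C (vcomp C m (M \<rhd> u)) (id_nat C M)"

locale monad_morphism =
  source: monad C M m u + target: monad C M' m' u' + nat: nat_trans C C M M' \<phi>
  for C :: "('o, 'm) cat"
    and M :: "('o, 'm, 'o, 'm) fctr" and m u :: "'o \<Rightarrow> 'm"
    and M' :: "('o, 'm, 'o, 'm) fctr" and m' u' :: "'o \<Rightarrow> 'm"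
    and \<phi> :: "'o \<Rightarrow> 'm" +
  assumes preserves_unit: "nat_eq C (vcomp C \<phi> u) u'"
    and preserves_mult: "nat_eq C (vcomp C \<phi> m) (vcomp C m' (hcomp C M M' \<phi> \<phi>))"

locale augmentation =
  monad C M m u + nat: nat_trans C C M id_fctr \<gamma>
  for C :: "('o, 'm) cat" and M :: "('o, 'm, 'o, 'm) fctr" and m u :: "'o \<Rightarrow> 'm"
    and \<gamma> :: "'o \<Rightarrow> 'm" +
  assumes aug_unit: "nat_eq C (vcomp C \<gamma> u) (id_nat C id_fctr)"
    and aug_mult: "nat_eq C (hcomp C M id_fctr \<gamma> \<gamma>) (vcomp C \<gamma> m)"


section \<open>Coequalizers\<close>

definition parallel :: "('o, 'm) cat \<Rightarrow> 'm \<Rightarrow> 'm \<Rightarrow> bool" where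
  "parallel C f g \<longleftrightarrow>
     f \<in> Arr C \<and> g \<in> Arr C \<and> Dom C f = Dom C g \<and> Cod C f = Cod C g"

definition is_coequalizer :: "('o, 'm) cat \<Rightarrow> 'm \<Rightarrow> 'm \<Rightarrow> 'm \<Rightarrow> bool" where
  "is_coequalizer C f g e \<longleftrightarrow>
     parallel C f g \<and> e \<in> Arr C \<and> Dom C e = Cod C f \<and> e \<cdot>\<^bsub>C\<^esub> f = e \<cdot>\<^bsub>C\<^esub> g \<and>
     (\<forall>h \<in> Arr C. Dom C h = Cod C f \<and> h \<cdot>\<^bsub>C\<^esub> f = h \<cdot>\<^bsub>C\<^esub> g \<longrightarrow>
        (\<exists>!k. k \<in> hom C (Cod C e) (Cod C h) \<and> k \<cdot>\<^bsub>C\<^esub> e = h))"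

definition has_coequalizers :: "('o, 'm) cat \<Rightarrow> bool" where
  "has_coequalizers C \<longleftrightarrow> (\<forall>f g. parallel C f g \<longrightarrow> (\<exists>e. is_coequalizer C f g e))"

definition coequalizer_choice :: "('o, 'm) cat \<Rightarrow> ('m \<Rightarrow> 'm \<Rightarrow> 'm) \<Rightarrow> bool" where
  "coequalizer_choice C q \<longleftrightarrow> (\<forall>f g. parallel C f g \<longrightarrow> is_coequalizer C f g (q f g))"

definition preserves_coequalizers ::
  "('o, 'm) cat \<Rightarrow> ('p, 'n) cat \<Rightarrow> ('o, 'm, 'p, 'n) fctr \<Rightarrow> bool" where
  "preserves_coequalizers C D F \<longleftrightarrow>
     (\<forall>f g e. is_coequalizer C f g e \<longrightarrow> is_coequalizer D (Fa F f) (Fa F g) (Fa F e))"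

definition regular_epi :: "('o, 'm) cat \<Rightarrow> 'm \<Rightarrow> bool" where
  "regular_epi C e \<longleftrightarrow> (\<exists>f g. is_coequalizer C f g e)"

definition preserves_regular_epis ::
  "('o, 'm) cat \<Rightarrow> ('p, 'n) cat \<Rightarrow> ('o, 'm, 'p, 'n) fctr \<Rightarrow> bool" where
  "preserves_regular_epis C D F \<longleftrightarrow> (\<forall>e. regular_epi C e \<longrightarrow> regular_epi D (Fa F e))"

text \<open>Nonempty finite composites; identities are regular epimorphisms, so the empty composite is
  included as well.\<close>

inductive composite_of_regular_epis :: "('o, 'm) cat \<Rightarrow> 'm \<Rightarrow> bool"
  for C :: "('o, 'm) cat" where
  single: "regular_epi C e \<Longrightarrow> composite_of_regular_epis C e"
| compose: "composite_of_regular_epis C f \<Longrightarrow> regular_epi C e \<Longrightarrow> Dom C e = Cod C f \<Longrightarrow>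
    composite_of_regular_epis C (e \<cdot>\<^bsub>C\<^esub> f)"

definition idempotent :: "('o, 'm) cat \<Rightarrow> 'm \<Rightarrow> bool" where
  "idempotent C e \<longleftrightarrow> e \<in> Arr C \<and> Dom C e = Cod C e \<and> e \<cdot>\<^bsub>C\<^esub> e = e"

definition preserves_idempotent_twisted_coequalizers ::
  "('o, 'm) cat \<Rightarrow> ('p, 'n) cat \<Rightarrow> ('o, 'm, 'p, 'n) fctr \<Rightarrow> bool" where
  "preserves_idempotent_twisted_coequalizers C D F \<longleftrightarrow>
     (\<forall>f e c. composite_of_regular_epis C f \<and> idempotent C e \<and> Cod C e = Dom C f \<and>
        is_coequalizer C (f \<cdot>\<^bsub>C\<^esub> e) f c \<longrightarrow>
        is_coequalizer D (Fa F (f \<cdot>\<^bsub>C\<^esub> e)) (Fa F f) (Fa F c))"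


section \<open>The adjoint decomposition\<close>

text \<open>The objects and arrows of all the categories \<open>B\<^sub>[\<^sub>n\<^sub>]\<close> live in the following two types.
  \<open>OBase\<close> and \<open>ABase\<close> are the identification \<open>B\<^sub>[\<^sub>0\<^sub>] = B\<close>, and \<open>OPair X b\<close> is the pair \<open>(X, b)\<close>.
  Since arrows determine their domain and codomain, an arrow \<open>f : (X, b) \<rightarrow> (X', b')\<close> of
  \<open>B\<^sub>[\<^sub>n\<^sub>+\<^sub>1\<^sub>]\<close> is recorded as \<open>APair (OPair X b) f (OPair X' b')\<close> with \<open>f : X \<rightarrow> X'\<close> in \<open>B\<^sub>[\<^sub>n\<^sub>]\<close>.\<close>

datatype ('b, 'f) tobj =
    OBase (obase: 'b)
  | OPair (opre: "('b, 'f) tobj") (omor: 'f)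

datatype ('b, 'f) tarr =
    ABase (abase: 'f)
  | APair (asrc: "('b, 'f) tobj") (apre: "('b, 'f) tarr") (atgt: "('b, 'f) tobj")

record ('b, 'f, 'a, 'g) stage =
  BB :: "(('b, 'f) tobj, ('b, 'f) tarr) cat"
  UU :: "(('b, 'f) tobj, ('b, 'f) tarr, 'b, 'f) fctr"
  LL :: "(('b, 'f) tobj, ('b, 'f) tarr, 'a, 'g) fctr"
  RR :: "('a, 'g, ('b, 'f) tobj, ('b, 'f) tarr) fctr"
  unitt :: "('b, 'f) tobj \<Rightarrow> ('b, 'f) tarr"
  counitt :: "'a \<Rightarrow> 'g"
  ppi :: "('b, 'f) tobj \<Rightarrow> 'g"

definition base_cat :: "('b, 'f) cat \<Rightarrow> (('b, 'f) tobj, ('b, 'f) tarr) cat" where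
  "base_cat B =
     \<lparr>Obj = OBase ` Obj B, Arr = ABase ` Arr B,
      Dom = (\<lambda>f. OBase (Dom B (abase f))), Cod = (\<lambda>f. OBase (Cod B (abase f))),
      Idn = (\<lambda>X. ABase (Idn B (obase X))),
      Cmp = (\<lambda>g f. ABase (abase g \<cdot>\<^bsub>B\<^esub> abase f))\<rparr>"

text \<open>The identity functor, seen as \<open>B \<rightarrow> B\<^sub>[\<^sub>0\<^sub>]\<close> and as \<open>B\<^sub>[\<^sub>0\<^sub>] \<rightarrow> B\<close> respectively.\<close>

definition wrap_fctr :: "('b, 'f, ('b, 'f) tobj, ('b, 'f) tarr) fctr" where
  "wrap_fctr = \<lparr>Fo = OBase, Fa = ABase\<rparr>"

definition unwrap_fctr :: "(('b, 'f) tobj, ('b, 'f) tarr, 'b, 'f) fctr" where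
  "unwrap_fctr = \<lparr>Fo = obase, Fa = abase\<rparr>"

definition base_stage ::
  "('b, 'f) cat \<Rightarrow> ('a, 'g) cat \<Rightarrow> ('b, 'f, 'a, 'g) fctr \<Rightarrow> ('a, 'g, 'b, 'f) fctr \<Rightarrow>
    ('b \<Rightarrow> 'f) \<Rightarrow> ('a \<Rightarrow> 'g) \<Rightarrow> ('b, 'f, 'a, 'g) stage" where
  "base_stage B A L R \<eta> \<epsilon> =
     \<lparr>BB = base_cat B, UU = unwrap_fctr, LL = L \<circ>\<^sub>F unwrap_fctr, RR = wrap_fctr \<circ>\<^sub>F R,
      unitt = (\<lambda>X. ABase (\<eta> (obase X))), counitt = \<epsilon>,
      ppi = id_nat A (L \<circ>\<^sub>F unwrap_fctr)\<rparr>"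

text \<open>The forgetful functor \<open>U\<^sub>[\<^sub>n\<^sub>,\<^sub>n\<^sub>+\<^sub>1\<^sub>]\<close>; it is given by the same map for all \<open>n\<close>.\<close>

definition forget :: "(('b, 'f) tobj, ('b, 'f) tarr, ('b, 'f) tobj, ('b, 'f) tarr) fctr" where
  "forget = \<lparr>Fo = opre, Fa = apre\<rparr>"

definition next_obj ::
  "('b, 'f) cat \<Rightarrow> ('a, 'g, 'b, 'f) fctr \<Rightarrow> ('b, 'f, 'a, 'g) stage \<Rightarrow> ('b, 'f) tobj set" where
  "next_obj B R S =
     {OPair X b | X b. X \<in> Obj (BB S) \<and> b \<in> hom B (Fo R (Fo (LL S) X)) (Fo (UU S) X)}"

definition next_cat ::
  "('b, 'f) cat \<Rightarrow> ('a, 'g, 'b, 'f) fctr \<Rightarrow> ('b, 'f, 'a, 'g) stage \<Rightarrow>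
    (('b, 'f) tobj, ('b, 'f) tarr) cat" where
  "next_cat B R S =
     \<lparr>Obj = next_obj B R S,
      Arr = {APair P f Q | P f Q. P \<in> next_obj B R S \<and> Q \<in> next_obj B R S \<and>
               f \<in> hom (BB S) (opre P) (opre Q) \<and>
               Fa (UU S) f \<cdot>\<^bsub>B\<^esub> omor P = omor Q \<cdot>\<^bsub>B\<^esub> Fa R (Fa (LL S) f)},
      Dom = asrc, Cod = atgt,
      Idn = (\<lambda>P. APair P (Idn (BB S) (opre P)) P),
      Cmp = (\<lambda>g f. APair (asrc f) (apre g \<cdot>\<^bsub>BB S\<^esub> apre f) (atgt g))\<rparr>"

text \<open>The component of \<open>\<pi>\<^sub>[\<^sub>n\<^sub>,\<^sub>n\<^sub>+\<^sub>1\<^sub>]\<close> at an object \<open>P\<close> of \<open>B\<^sub>[\<^sub>n\<^sub>+\<^sub>1\<^sub>]\<close>, for the choice \<open>q\<close> of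
  coequalizers in \<open>A\<close>.\<close>

definition pi_step ::
  "('a, 'g) cat \<Rightarrow> ('b, 'f, 'a, 'g) fctr \<Rightarrow> ('a \<Rightarrow> 'g) \<Rightarrow> ('g \<Rightarrow> 'g \<Rightarrow> 'g) \<Rightarrow>
    ('b, 'f, 'a, 'g) stage \<Rightarrow> ('b, 'f) tobj \<Rightarrow> 'g" where
  "pi_step A L \<epsilon> q S P =
     q (ppi S (opre P) \<cdot>\<^bsub>A\<^esub> Fa L (omor P)) (\<epsilon> (Fo (LL S) (opre P)))"

text \<open>On arrows, \<open>L\<^sub>[\<^sub>n\<^sub>+\<^sub>1\<^sub>]\<close> is the map induced on coequalizers, that is, the unique arrow making
  \<open>\<pi>\<^sub>[\<^sub>n\<^sub>,\<^sub>n\<^sub>+\<^sub>1\<^sub>]\<close> natural. The counit below is likewise the unique solution of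
  \<open>\<epsilon>\<^sub>[\<^sub>n\<^sub>+\<^sub>1\<^sub>] \<circ> \<pi>\<^sub>[\<^sub>n\<^sub>,\<^sub>n\<^sub>+\<^sub>1\<^sub>]R\<^sub>[\<^sub>n\<^sub>+\<^sub>1\<^sub>] = \<epsilon>\<^sub>[\<^sub>n\<^sub>]\<close>.\<close>

definition next_L ::
  "('a, 'g) cat \<Rightarrow> ('b, 'f, 'a, 'g) fctr \<Rightarrow> ('a \<Rightarrow> 'g) \<Rightarrow> ('g \<Rightarrow> 'g \<Rightarrow> 'g) \<Rightarrow>
    ('b, 'f, 'a, 'g) stage \<Rightarrow> (('b, 'f) tobj, ('b, 'f) tarr, 'a, 'g) fctr" where
  "next_L A L \<epsilon> q S =
     \<lparr>Fo = (\<lambda>P. Cod A (pi_step A L \<epsilon> q S P)),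
      Fa = (\<lambda>f. THE h.
              h \<in> hom A (Cod A (pi_step A L \<epsilon> q S (asrc f))) (Cod A (pi_step A L \<epsilon> q S (atgt f))) \<and>
              h \<cdot>\<^bsub>A\<^esub> pi_step A L \<epsilon> q S (asrc f) =
                pi_step A L \<epsilon> q S (atgt f) \<cdot>\<^bsub>A\<^esub> Fa (LL S) (apre f))\<rparr>"

definition next_R ::
  "('a, 'g) cat \<Rightarrow> ('a, 'g, 'b, 'f) fctr \<Rightarrow> ('b, 'f, 'a, 'g) stage \<Rightarrow>
    ('a, 'g, ('b, 'f) tobj, ('b, 'f) tarr) fctr" where
  "next_R A R S =
     (let T = (\<lambda>X. OPair (Fo (RR S) X) (Fa R (counitt S X)))
      in \<lparr>Fo = T, Fa = (\<lambda>f. APair (T (Dom A f)) (Fa (RR S) f) (T (Cod A f)))\<rparr>)"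

definition next_unit ::
  "('a, 'g) cat \<Rightarrow> ('b, 'f, 'a, 'g) fctr \<Rightarrow> ('a, 'g, 'b, 'f) fctr \<Rightarrow> ('a \<Rightarrow> 'g) \<Rightarrow>
    ('g \<Rightarrow> 'g \<Rightarrow> 'g) \<Rightarrow> ('b, 'f, 'a, 'g) stage \<Rightarrow> ('b, 'f) tobj \<Rightarrow> ('b, 'f) tarr" where
  "next_unit A L R \<epsilon> q S P =
     APair P (Fa (RR S) (pi_step A L \<epsilon> q S P) \<cdot>\<^bsub>BB S\<^esub> unitt S (opre P))
       (Fo (next_R A R S) (Fo (next_L A L \<epsilon> q S) P))"

definition next_counit ::
  "('a, 'g) cat \<Rightarrow> ('b, 'f, 'a, 'g) fctr \<Rightarrow> ('a, 'g, 'b, 'f) fctr \<Rightarrow> ('a \<Rightarrow> 'g) \<Rightarrow>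
    ('g \<Rightarrow> 'g \<Rightarrow> 'g) \<Rightarrow> ('b, 'f, 'a, 'g) stage \<Rightarrow> 'a \<Rightarrow> 'g" where
  "next_counit A L R \<epsilon> q S X =
     (THE h. h \<in> hom A (Fo (next_L A L \<epsilon> q S) (Fo (next_R A R S) X)) X \<and>
        h \<cdot>\<^bsub>A\<^esub> pi_step A L \<epsilon> q S (Fo (next_R A R S) X) = counitt S X)"

definition next_stage ::
  "('b, 'f) cat \<Rightarrow> ('a, 'g) cat \<Rightarrow> ('b, 'f, 'a, 'g) fctr \<Rightarrow> ('a, 'g, 'b, 'f) fctr \<Rightarrow>
    ('a \<Rightarrow> 'g) \<Rightarrow> ('g \<Rightarrow> 'g \<Rightarrow> 'g) \<Rightarrow> ('b, 'f, 'a, 'g) stage \<Rightarrow> ('b, 'f, 'a, 'g) stage" where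
  "next_stage B A L R \<epsilon> q S =
     \<lparr>BB = next_cat B R S, UU = UU S \<circ>\<^sub>F forget, LL = next_L A L \<epsilon> q S, RR = next_R A R S,
      unitt = next_unit A L R \<epsilon> q S, counitt = next_counit A L R \<epsilon> q S,
      ppi = vcomp A (pi_step A L \<epsilon> q S) (ppi S \<lhd> forget)\<rparr>"

primrec decomp ::
  "('b, 'f) cat \<Rightarrow> ('a, 'g) cat \<Rightarrow> ('b, 'f, 'a, 'g) fctr \<Rightarrow> ('a, 'g, 'b, 'f) fctr \<Rightarrow>
    ('b \<Rightarrow> 'f) \<Rightarrow> ('a \<Rightarrow> 'g) \<Rightarrow> ('g \<Rightarrow> 'g \<Rightarrow> 'g) \<Rightarrow> nat \<Rightarrow> ('b, 'f, 'a, 'g) stage" where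
  "decomp B A L R \<eta> \<epsilon> q 0 = base_stage B A L R \<eta> \<epsilon>"
| "decomp B A L R \<eta> \<epsilon> q (Suc n) = next_stage B A L R \<epsilon> q (decomp B A L R \<eta> \<epsilon> q n)"

definition decomp_pi ::
  "('b, 'f) cat \<Rightarrow> ('a, 'g) cat \<Rightarrow> ('b, 'f, 'a, 'g) fctr \<Rightarrow> ('a, 'g, 'b, 'f) fctr \<Rightarrow>
    ('b \<Rightarrow> 'f) \<Rightarrow> ('a \<Rightarrow> 'g) \<Rightarrow> ('g \<Rightarrow> 'g \<Rightarrow> 'g) \<Rightarrow> nat \<Rightarrow> ('b, 'f) tobj \<Rightarrow> 'g" where
  "decomp_pi B A L R \<eta> \<epsilon> q n = pi_step A L \<epsilon> q (decomp B A L R \<eta> \<epsilon> q n)"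


section \<open>The comparison transformation\<close>

text \<open>The composite \<open>R'F\<epsilon> \<circ> \<eta>'R\<close> is defined because \<open>R'L'R = R'FLR\<close> when \<open>FL = L'\<close>.\<close>

definition comparison ::
  "('b, 'f) cat \<Rightarrow> ('a, 'g, 'b, 'f) fctr \<Rightarrow> ('a \<Rightarrow> 'g) \<Rightarrow> ('c, 'h, 'b, 'f) fctr \<Rightarrow>
    ('b \<Rightarrow> 'f) \<Rightarrow> ('a, 'g, 'c, 'h) fctr \<Rightarrow> 'a \<Rightarrow> 'f" where
  "comparison B R \<epsilon> R' \<eta>' F = vcomp B ((R' \<circ>\<^sub>F F) \<rhd> \<epsilon>) (\<eta>' \<lhd> R)"

end

theory Submission
  imports Defs
begin

text \<open>
  The transformation \<open>\<xi>\<close> is the transpose of \<open>F\<epsilon>\<close>, so that \<open>\<xi>L\<close> is a morphism of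
  monads by the naturality of units and counits, and augmentations pull back along morphisms of
  monads (\<open>\<xi>L_monad_morphism\<close>, \<open>monad_morphism_pulls_back_augmentation\<close>).

  Along the decomposition it is not \<open>\<gamma>\<^sub>[\<^sub>n\<^sub>]\<close> that is propagated, but an extension
  \<open>\<delta> : R'FL\<^sub>[\<^sub>n\<^sub>]\<Gamma>\<^sub>[\<^sub>n\<^sub>] \<rightarrow> Id\<close> of \<open>\<gamma>'\<close>, that is, \<open>\<delta> \<circ> R'F\<pi>\<^sub>[\<^sub>n\<^sub>]\<Gamma>\<^sub>[\<^sub>n\<^sub>] = \<gamma>'\<close>; one puts
  \<open>\<gamma>\<^sub>[\<^sub>n\<^sub>] = \<delta> \<circ> \<xi>L\<^sub>[\<^sub>n\<^sub>]\<Gamma>\<^sub>[\<^sub>n\<^sub>]\<close>. The identity \<open>\<gamma>\<^sub>[\<^sub>n\<^sub>] \<circ> s = Id\<close> for \<open>s = U\<^sub>[\<^sub>n\<^sub>]\<eta>\<^sub>[\<^sub>n\<^sub>]\<Gamma>\<^sub>[\<^sub>n\<^sub>]\<close> is then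
  the unit law of \<open>\<gamma>'\<close>, because \<open>s = R\<pi>\<^sub>[\<^sub>n\<^sub>] \<circ> \<eta>\<close>. To pass to the next stage, \<open>\<delta>\<close> must be factored
  through \<open>R'F\<close> of the coequalizer of \<open>\<pi>\<^sub>[\<^sub>n\<^sub>] \<circ> L\<gamma>\<^sub>[\<^sub>n\<^sub>]\<close> and \<open>\<epsilon>L\<^sub>[\<^sub>n\<^sub>]\<close>. Two facts are needed.

  First, \<open>\<delta>\<close> coequalizes the images of these arrows. This follows from \<open>\<delta>\<close> being a morphism of
  \<open>R'L'\<close>-algebras (\<open>\<delta>_algebra_morphism\<close>), which is deduced from the same property of \<open>\<gamma>'\<close> after
  cancelling the epimorphism \<open>R'L'R'F\<pi>\<^sub>[\<^sub>n\<^sub>]\<close>.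

  Second, \<open>R'F\<close> preserves this coequalizer (\<open>R'F\<pi>_coequalizer\<close>). Since
  \<open>\<epsilon>L\<^sub>[\<^sub>n\<^sub>] \<circ> Ls = \<pi>\<^sub>[\<^sub>n\<^sub>]\<close>, the pair is \<open>(fe, f)\<close> for \<open>f = \<epsilon>L\<^sub>[\<^sub>n\<^sub>]\<close> and the idempotent
  \<open>e = L(s \<circ> \<gamma>\<^sub>[\<^sub>n\<^sub>])\<close>. It remains to see that \<open>f\<close> is a composite of regular epimorphisms. It is a
  left factor of the composite \<open>\<pi>\<^sub>[\<^sub>n\<^sub>]\<close> of coequalizers, and in a category with coequalizers a left
  factor \<open>f\<close> of a composite \<open>f \<circ> s\<close> of regular epimorphisms is again one
  (\<open>composite_left_factor\<close>): push \<open>f \<circ> s\<close> out along \<open>s\<close>; then \<open>f\<close> is the resulting composite of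
  regular epimorphisms followed by a split epimorphism.
\<close>

section \<open>Composition calculus\<close>

lemma in_hom [simp]: "f \<in> hom C X Y \<longleftrightarrow> f \<in> Arr C \<and> Dom C f = X \<and> Cod C f = Y"
  by (simp add: hom_def)

lemma comp_fctr_simps [simp]:
  "Fo (G \<circ>\<^sub>F H) X = Fo G (Fo H X)" "Fa (G \<circ>\<^sub>F H) f = Fa G (Fa H f)"
  by (simp_all add: comp_fctr_def)

lemma id_fctr_simps [simp]: "Fo id_fctr X = X" "Fa id_fctr f = f"
  by (simp_all add: id_fctr_def)

lemmas whisker_defs = nat_eq_def vcomp_def whisker_left_def whisker_right_def id_nat_def hcomp_def

context category
begin

lemma arr_obj [simp]:
  "f \<in> Arr C \<Longrightarrow> Dom C f \<in> Obj C" "f \<in> Arr C \<Longrightarrow> Cod C f \<in> Obj C"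
  by (auto intro: dom_obj cod_obj)

lemma idn_arr [simp]:
  assumes "X \<in> Obj C"
  shows "Idn C X \<in> Arr C" "Dom C (Idn C X) = X" "Cod C (Idn C X) = X"
  using idn_hom[OF assms] by auto

lemma cmp_arr [simp]:
  assumes "f \<in> Arr C" "g \<in> Arr C" "Dom C g = Cod C f"
  shows "g \<cdot> f \<in> Arr C" "Dom C (g \<cdot> f) = Dom C f" "Cod C (g \<cdot> f) = Cod C g"
  using cmp_hom[of f "Dom C f" "Cod C f" g "Cod C g"] assms by auto

lemma cmp_idn [simp]:
  "f \<in> Arr C \<Longrightarrow> X = Dom C f \<Longrightarrow> f \<cdot> Idn C X = f"
  "f \<in> Arr C \<Longrightarrow> Y = Cod C f \<Longrightarrow> Idn C Y \<cdot> f = f"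
  using idn_right[of f "Dom C f" "Cod C f"] idn_left[of f "Dom C f" "Cod C f"] by auto

lemma cmp_right_assoc [simp]:
  "f \<in> Arr C \<Longrightarrow> g \<in> Arr C \<Longrightarrow> h \<in> Arr C \<Longrightarrow> Dom C g = Cod C f \<Longrightarrow> Dom C h = Cod C g \<Longrightarrow>
    (h \<cdot> g) \<cdot> f = h \<cdot> (g \<cdot> f)"
  using cmp_assoc[of f "Dom C f" "Cod C f" g "Cod C g" h "Cod C h"] by simp

text \<open>Since composites are normalised to the right, an equation between binary composites is
  applied inside a longer one in this form.\<close>

lemma cmp_extend:
  assumes "h \<cdot> g = k" "f \<in> Arr C" "g \<in> Arr C" "h \<in> Arr C" "Dom C g = Cod C f" "Dom C h = Cod C g"
  shows "h \<cdot> (g \<cdot> f) = k \<cdot> f"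
  using assms cmp_right_assoc[of f g h] by simp

end

context cfunctor
begin

lemma fo_in [simp]: "X \<in> Obj C \<Longrightarrow> Fo F X \<in> Obj D"
  by (rule fo_obj)

lemma fa_arr [simp]:
  assumes "f \<in> Arr C"
  shows "Fa F f \<in> Arr D" "Dom D (Fa F f) = Fo F (Dom C f)" "Cod D (Fa F f) = Fo F (Cod C f)"
  using fa_hom[of f "Dom C f" "Cod C f"] assms by auto

lemma fa_idn' [simp]: "X \<in> Obj C \<Longrightarrow> Fa F (Idn C X) = Idn D (Fo F X)"
  by (rule fa_idn)

lemma fa_cmp' [simp]:
  "f \<in> Arr C \<Longrightarrow> g \<in> Arr C \<Longrightarrow> Dom C g = Cod C f \<Longrightarrow>
    Fa F (g \<cdot>\<^bsub>C\<^esub> f) = Fa F g \<cdot>\<^bsub>D\<^esub> Fa F f"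
  using fa_cmp[of f "Dom C f" "Cod C f" g "Cod C g"] by simp

end

lemma cfunctorI:
  assumes "category C" "category D"
    and "\<And>X. X \<in> Obj C \<Longrightarrow> Fo F X \<in> Obj D"
    and "\<And>f. f \<in> Arr C \<Longrightarrow>
      Fa F f \<in> Arr D \<and> Dom D (Fa F f) = Fo F (Dom C f) \<and> Cod D (Fa F f) = Fo F (Cod C f)"
    and "\<And>X. X \<in> Obj C \<Longrightarrow> Fa F (Idn C X) = Idn D (Fo F X)"
    and "\<And>f g. f \<in> Arr C \<Longrightarrow> g \<in> Arr C \<Longrightarrow> Dom C g = Cod C f \<Longrightarrow>
      Fa F (g \<cdot>\<^bsub>C\<^esub> f) = Fa F g \<cdot>\<^bsub>D\<^esub> Fa F f"
  shows "cfunctor C D F"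
  using assms unfolding cfunctor_def cfunctor_axioms_def by auto

lemma id_cfunctor:
  assumes "category C"
  shows "cfunctor C C id_fctr"
  by (rule cfunctorI) (auto simp: assms)

lemma comp_cfunctor:
  assumes "cfunctor C D H" "cfunctor D E G"
  shows "cfunctor C E (G \<circ>\<^sub>F H)"
proof -
  interpret H: cfunctor C D H by fact
  interpret G: cfunctor D E G by fact
  show ?thesis
    by (rule cfunctorI) (auto simp: H.source.category_axioms G.target.category_axioms)
qed

context nat_trans
begin

lemma component_arr [simp]:
  assumes "X \<in> Obj C"
  shows "\<tau> X \<in> Arr D" "Dom D (\<tau> X) = Fo F X" "Cod D (\<tau> X) = Fo G X"
  using component_hom[OF assms] by auto

lemma natural:
  "f \<in> Arr C \<Longrightarrow> Dom C f = X \<Longrightarrow> Cod C f = Y \<Longrightarrow> \<tau> Y \<cdot>\<^bsub>D\<^esub> Fa F f = Fa G f \<cdot>\<^bsub>D\<^esub> \<tau> X"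
  using naturality[of f X Y] by simp

end

lemma nat_transI:
  assumes "cfunctor C D F" "cfunctor C D G"
    and "\<And>X. X \<in> Obj C \<Longrightarrow> \<tau> X \<in> Arr D \<and> Dom D (\<tau> X) = Fo F X \<and> Cod D (\<tau> X) = Fo G X"
    and "\<And>f. f \<in> Arr C \<Longrightarrow> \<tau> (Cod C f) \<cdot>\<^bsub>D\<^esub> Fa F f = Fa G f \<cdot>\<^bsub>D\<^esub> \<tau> (Dom C f)"
  shows "nat_trans C D F G \<tau>"
  using assms unfolding nat_trans_def nat_trans_axioms_def by auto

context adjunction
begin

lemma triangle_L_at [simp]: "X \<in> Obj B \<Longrightarrow> \<epsilon> (Fo L X) \<cdot>\<^bsub>A\<^esub> Fa L (\<eta> X) = Idn A (Fo L X)"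
  using triangle_L by (auto simp: whisker_defs)

lemma triangle_R_at [simp]: "X \<in> Obj A \<Longrightarrow> Fa R (\<epsilon> X) \<cdot>\<^bsub>B\<^esub> \<eta> (Fo R X) = Idn B (Fo R X)"
  using triangle_R by (auto simp: whisker_defs)

lemma unit_natural:
  "f \<in> Arr B \<Longrightarrow> \<eta> (Cod B f) \<cdot>\<^bsub>B\<^esub> f = Fa R (Fa L f) \<cdot>\<^bsub>B\<^esub> \<eta> (Dom B f)"
  using unit.natural[of f] by simp

lemma counit_natural:
  "f \<in> Arr A \<Longrightarrow> \<epsilon> (Cod A f) \<cdot>\<^bsub>A\<^esub> Fa L (Fa R f) = f \<cdot>\<^bsub>A\<^esub> \<epsilon> (Dom A f)"
  using counit.natural[of f] by simp

lemma transpose_inverse: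
  assumes "h \<in> Arr A" "X \<in> Obj B" "Dom A h = Fo L X"
  shows "\<epsilon> (Cod A h) \<cdot>\<^bsub>A\<^esub> Fa L (Fa R h \<cdot>\<^bsub>B\<^esub> \<eta> X) = h"
proof -
  have "\<epsilon> (Cod A h) \<cdot>\<^bsub>A\<^esub> (Fa L (Fa R h) \<cdot>\<^bsub>A\<^esub> Fa L (\<eta> X)) = (h \<cdot>\<^bsub>A\<^esub> \<epsilon> (Dom A h)) \<cdot>\<^bsub>A\<^esub> Fa L (\<eta> X)"
    by (rule L.target.cmp_extend[OF counit_natural]) (use assms in auto)
  then show ?thesis using assms by simp
qed

lemma induced_monad: "monad B (R \<circ>\<^sub>F L) (R \<rhd> (\<epsilon> \<lhd> L)) \<eta>"
proof -
  have RL: "cfunctor B B (R \<circ>\<^sub>F L)"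
    by (rule unit.right.cfunctor_axioms)
  have nat: "Fa R (\<epsilon> (Fo L (Cod B f))) \<cdot>\<^bsub>B\<^esub> Fa R (Fa L (Fa R (Fa L f))) =
      Fa R (Fa L f) \<cdot>\<^bsub>B\<^esub> Fa R (\<epsilon> (Fo L (Dom B f)))" if "f \<in> Arr B" for f
    using that arg_cong[OF counit_natural[of "Fa L f"], of "Fa R"] by simp
  have assoc: "Fa R (\<epsilon> (Fo L X)) \<cdot>\<^bsub>B\<^esub> Fa R (Fa L (Fa R (\<epsilon> (Fo L X)))) =
      Fa R (\<epsilon> (Fo L X)) \<cdot>\<^bsub>B\<^esub> Fa R (\<epsilon> (Fo L (Fo R (Fo L X))))" if "X \<in> Obj B" for X
    using that arg_cong[OF counit_natural[of "\<epsilon> (Fo L X)"], of "Fa R"] by simp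
  have unit: "Fa R (\<epsilon> (Fo L X)) \<cdot>\<^bsub>B\<^esub> Fa R (Fa L (\<eta> X)) = Idn B (Fo R (Fo L X))"
    if "X \<in> Obj B" for X
    using that arg_cong[OF triangle_L_at[of X], of "Fa R"] by (simp del: triangle_L_at)
  have "nat_trans B B ((R \<circ>\<^sub>F L) \<circ>\<^sub>F (R \<circ>\<^sub>F L)) (R \<circ>\<^sub>F L) (R \<rhd> (\<epsilon> \<lhd> L))"
    by (rule nat_transI) (auto simp: RL comp_cfunctor[OF RL RL] whisker_defs nat)
  then show ?thesis
    unfolding monad_def monad_axioms_def
    by (auto simp: unit.nat_trans_axioms whisker_defs assoc unit)
qed

end

lemma monad_morphism_pulls_back_augmentation:
  assumes "monad_morphism C M m u M' m' u' \<phi>" "augmentation C M' m' u' \<gamma>'"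
  shows "augmentation C M m u (vcomp C \<gamma>' \<phi>)"
proof -
  interpret C: category C
    using assms(1) by (simp add: monad_morphism_def nat_trans_def cfunctor_def)
  interpret monad_morphism C M m u M' m' u' \<phi> by fact
  have M: "cfunctor C C M"
    using assms(1) by (simp add: monad_morphism_def nat_trans_def)
  interpret aug: augmentation C M' m' u' \<gamma>' by fact
  have nat_\<gamma>': "\<gamma>' (Cod C f) \<cdot>\<^bsub>C\<^esub> Fa M' f = f \<cdot>\<^bsub>C\<^esub> \<gamma>' (Dom C f)" if "f \<in> Arr C" for f
    using aug.nat.natural[OF that] by simp
  have nat_\<phi>: "\<phi> (Cod C f) \<cdot>\<^bsub>C\<^esub> Fa M f = Fa M' f \<cdot>\<^bsub>C\<^esub> \<phi> (Dom C f)" if "f \<in> Arr C" for f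
    using nat.natural[OF that] by simp
  have preserved_unit: "\<phi> X \<cdot>\<^bsub>C\<^esub> u X = u' X" if "X \<in> Obj C" for X
    using that preserves_unit by (auto simp: whisker_defs)
  have preserved_mult: "m' X \<cdot>\<^bsub>C\<^esub> (\<phi> (Fo M' X) \<cdot>\<^bsub>C\<^esub> Fa M (\<phi> X)) = \<phi> X \<cdot>\<^bsub>C\<^esub> m X" if "X \<in> Obj C" for X
    using that preserves_mult by (auto simp: whisker_defs)
  have aug_unit: "\<gamma>' X \<cdot>\<^bsub>C\<^esub> u' X = Idn C X" if "X \<in> Obj C" for X
    using that aug.aug_unit by (auto simp: whisker_defs)
  have aug_mult: "\<gamma>' X \<cdot>\<^bsub>C\<^esub> Fa M' (\<gamma>' X) = \<gamma>' X \<cdot>\<^bsub>C\<^esub> m' X" if "X \<in> Obj C" for X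
    using that aug.aug_mult by (auto simp: whisker_defs)
  have nat_\<gamma>: "\<gamma>' (Cod C f) \<cdot>\<^bsub>C\<^esub> (\<phi> (Cod C f) \<cdot>\<^bsub>C\<^esub> Fa M f) = f \<cdot>\<^bsub>C\<^esub> (\<gamma>' (Dom C f) \<cdot>\<^bsub>C\<^esub> \<phi> (Dom C f))"
    if "f \<in> Arr C" for f
    using that C.cmp_extend[OF nat_\<gamma>'[OF that], of "\<phi> (Dom C f)"] nat_\<phi>[OF that]
    by simp
  have "\<gamma>' X \<cdot>\<^bsub>C\<^esub> (\<phi> X \<cdot>\<^bsub>C\<^esub> (Fa M (\<gamma>' X) \<cdot>\<^bsub>C\<^esub> Fa M (\<phi> X))) = \<gamma>' X \<cdot>\<^bsub>C\<^esub> (\<phi> X \<cdot>\<^bsub>C\<^esub> m X)"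
    if X: "X \<in> Obj C" for X
  proof -
    have "\<phi> X \<cdot>\<^bsub>C\<^esub> (Fa M (\<gamma>' X) \<cdot>\<^bsub>C\<^esub> Fa M (\<phi> X)) = (Fa M' (\<gamma>' X) \<cdot>\<^bsub>C\<^esub> \<phi> (Fo M' X)) \<cdot>\<^bsub>C\<^esub> Fa M (\<phi> X)"
      by (rule C.cmp_extend) (use X nat_\<phi>[of "\<gamma>' X"] in auto)
    then have "\<gamma>' X \<cdot>\<^bsub>C\<^esub> (\<phi> X \<cdot>\<^bsub>C\<^esub> (Fa M (\<gamma>' X) \<cdot>\<^bsub>C\<^esub> Fa M (\<phi> X))) =
        \<gamma>' X \<cdot>\<^bsub>C\<^esub> (Fa M' (\<gamma>' X) \<cdot>\<^bsub>C\<^esub> (\<phi> (Fo M' X) \<cdot>\<^bsub>C\<^esub> Fa M (\<phi> X)))"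
      using X by simp
    also have "\<dots> = (\<gamma>' X \<cdot>\<^bsub>C\<^esub> m' X) \<cdot>\<^bsub>C\<^esub> (\<phi> (Fo M' X) \<cdot>\<^bsub>C\<^esub> Fa M (\<phi> X))"
      by (rule C.cmp_extend) (use X aug_mult in auto)
    also have "\<dots> = \<gamma>' X \<cdot>\<^bsub>C\<^esub> (\<phi> X \<cdot>\<^bsub>C\<^esub> m X)"
      using X preserved_mult by simp
    finally show ?thesis .
  qed
  moreover have "nat_trans C C M id_fctr (vcomp C \<gamma>' \<phi>)"
    by (rule nat_transI)
      (auto simp: M id_cfunctor[OF C.category_axioms]
        whisker_defs nat_\<gamma>)
  ultimately show ?thesis
    unfolding augmentation_def augmentation_axioms_def
    by (auto simp: source.monad_axioms whisker_defs preserved_unit aug_unit)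
qed


section \<open>Composites of regular epimorphisms\<close>

lemma is_coequalizerD:
  assumes "is_coequalizer C f g e"
  shows "f \<in> Arr C" "g \<in> Arr C" "e \<in> Arr C" "Dom C f = Dom C g" "Cod C g = Cod C f"
    "Dom C e = Cod C f" "e \<cdot>\<^bsub>C\<^esub> f = e \<cdot>\<^bsub>C\<^esub> g"
  using assms unfolding is_coequalizer_def parallel_def by auto

lemma coequalizer_factors_uniquely:
  assumes "is_coequalizer C f g e" "h \<in> Arr C" "Dom C h = Cod C f" "h \<cdot>\<^bsub>C\<^esub> f = h \<cdot>\<^bsub>C\<^esub> g"
  shows "\<exists>!k. k \<in> hom C (Cod C e) (Cod C h) \<and> k \<cdot>\<^bsub>C\<^esub> e = h"
  using assms unfolding is_coequalizer_def by blast

lemma coequalizer_factor: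
  assumes "is_coequalizer C f g e" "h \<in> Arr C" "Dom C h = Cod C f" "h \<cdot>\<^bsub>C\<^esub> f = h \<cdot>\<^bsub>C\<^esub> g"
  obtains k where "k \<in> Arr C" "Dom C k = Cod C e" "Cod C k = Cod C h" "k \<cdot>\<^bsub>C\<^esub> e = h"
  using coequalizer_factors_uniquely[OF assms] by auto

lemma preserves_regular_episI:
  "preserves_coequalizers C D F \<Longrightarrow> preserves_regular_epis C D F"
  unfolding preserves_coequalizers_def preserves_regular_epis_def regular_epi_def by blast

lemma regular_epi_arr: "regular_epi C e \<Longrightarrow> e \<in> Arr C"
  unfolding regular_epi_def by (auto dest: is_coequalizerD)

text \<open>The square \<open>q \<cdot> s = k \<cdot> g\<close> is a pushout, except that a factorization through \<open>q\<close> is not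
  required to be unique.\<close>

definition weak_pushout ::
  "('o, 'm) cat \<Rightarrow> 'm \<Rightarrow> 'm \<Rightarrow> 'm \<Rightarrow> 'm \<Rightarrow> bool" where
  "weak_pushout C g s k q \<longleftrightarrow>
     q \<in> Arr C \<and> k \<in> Arr C \<and> Dom C q = Cod C s \<and> Dom C k = Cod C g \<and> Cod C k = Cod C q \<and>
     q \<cdot>\<^bsub>C\<^esub> s = k \<cdot>\<^bsub>C\<^esub> g \<and>
     (\<forall>f m. f \<in> Arr C \<and> m \<in> Arr C \<and> Dom C f = Cod C s \<and> Dom C m = Cod C g \<and>
        f \<cdot>\<^bsub>C\<^esub> s = m \<cdot>\<^bsub>C\<^esub> g \<longrightarrow>
        (\<exists>l. l \<in> Arr C \<and> Dom C l = Cod C q \<and> l \<cdot>\<^bsub>C\<^esub> q = f))"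

lemma weak_pushoutD:
  assumes "weak_pushout C g s k q"
  shows "q \<in> Arr C" "k \<in> Arr C" "Dom C q = Cod C s" "Dom C k = Cod C g" "Cod C k = Cod C q"
    "q \<cdot>\<^bsub>C\<^esub> s = k \<cdot>\<^bsub>C\<^esub> g"
  using assms by (simp_all add: weak_pushout_def)

lemma weak_pushout_factor:
  assumes "weak_pushout C g s k q" "f \<in> Arr C" "m \<in> Arr C" "Dom C f = Cod C s" "Dom C m = Cod C g"
    "f \<cdot>\<^bsub>C\<^esub> s = m \<cdot>\<^bsub>C\<^esub> g"
  obtains l where "l \<in> Arr C" "Dom C l = Cod C q" "l \<cdot>\<^bsub>C\<^esub> q = f"
  using assms by (auto simp: weak_pushout_def)

context category
begin

lemma coequalizer_epi:
  assumes e: "is_coequalizer C f g e"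
    and h: "h \<in> Arr C" "Dom C h = Cod C e" and k: "k \<in> Arr C" "Dom C k = Cod C e"
    and eq: "h \<cdot> e = k \<cdot> e"
  shows "h = k"
proof -
  note e' = is_coequalizerD[OF e]
  have cods: "Cod C h = Cod C k"
    using arg_cong[OF eq, of "Cod C"] e' h k by simp
  have "(h \<cdot> e) \<cdot> f = (h \<cdot> e) \<cdot> g"
    using e' h by simp
  moreover have "h \<cdot> e \<in> Arr C" "Dom C (h \<cdot> e) = Cod C f"
    using e' h by auto
  ultimately have "\<exists>!l. l \<in> hom C (Cod C e) (Cod C (h \<cdot> e)) \<and> l \<cdot> e = h \<cdot> e"
    by (intro coequalizer_factors_uniquely[OF e]) auto
  then show ?thesis
    using h k eq cods e' by auto
qed

lemma regular_epi_cancel: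
  assumes "regular_epi C e" "h \<in> Arr C" "Dom C h = Cod C e" "k \<in> Arr C" "Dom C k = Cod C e"
    "h \<cdot> e = k \<cdot> e"
  shows "h = k"
  using assms coequalizer_epi unfolding regular_epi_def by blast

lemma composite_arr: "composite_of_regular_epis C f \<Longrightarrow> f \<in> Arr C"
  by (induction rule: composite_of_regular_epis.induct) (auto dest: regular_epi_arr)

lemma composite_cancel:
  assumes "composite_of_regular_epis C e" "h \<in> Arr C" "Dom C h = Cod C e"
    "k \<in> Arr C" "Dom C k = Cod C e" "h \<cdot> e = k \<cdot> e"
  shows "h = k"
  using assms
proof (induction arbitrary: h k rule: composite_of_regular_epis.induct)
  case (single e)
  then show ?case using regular_epi_cancel by blast
next
  case (compose f e)
  note arrs = regular_epi_arr[OF compose.hyps(2)] composite_arr[OF compose.hyps(1)]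
  have "h \<cdot> e = k \<cdot> e"
    by (rule compose.IH) (use compose.prems compose.hyps arrs in auto)
  then show ?case
    using regular_epi_cancel[OF compose.hyps(2), of h k] compose.prems compose.hyps arrs by auto
qed

lemma split_epi_regular:
  assumes f: "f \<in> Arr C" "s \<in> Arr C" "Dom C f = Cod C s" "f \<cdot> s = Idn C (Cod C f)"
  shows "regular_epi C f"
proof -
  have s: "Dom C s = Cod C f"
    by (metis arr_obj(2) cmp_arr(2) f idn_arr(2))
  have "is_coequalizer C (s \<cdot> f) (Idn C (Dom C f)) f"
    unfolding is_coequalizer_def
  proof (intro conjI ballI impI)
    show "parallel C (s \<cdot> f) (Idn C (Dom C f))"
      using f s by (simp add: parallel_def)
    show "f \<cdot> (s \<cdot> f) = f \<cdot> Idn C (Dom C f)"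
      using cmp_extend[OF f(4), of f] f s by simp
    fix h
    assume h: "h \<in> Arr C"
      and "Dom C h = Cod C (s \<cdot> f) \<and> h \<cdot> (s \<cdot> f) = h \<cdot> Idn C (Dom C f)"
    then have h': "Dom C h = Dom C f" "(h \<cdot> s) \<cdot> f = h"
      using f s by auto
    show "\<exists>!k. k \<in> hom C (Cod C f) (Cod C h) \<and> k \<cdot> f = h"
    proof (rule ex1I)
      show "h \<cdot> s \<in> hom C (Cod C f) (Cod C h) \<and> (h \<cdot> s) \<cdot> f = h"
        using f s h h' by auto
      fix k
      assume k: "k \<in> hom C (Cod C f) (Cod C h) \<and> k \<cdot> f = h"
      then have "h \<cdot> s = k \<cdot> (f \<cdot> s)"
        using f s h cmp_right_assoc[of s f k] by simp
      then show "k = h \<cdot> s"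
        using f k by simp
    qed
  qed (use f s in auto)
  then show ?thesis
    unfolding regular_epi_def by blast
qed

lemma idn_regular_epi: "X \<in> Obj C \<Longrightarrow> regular_epi C (Idn C X)"
  by (rule split_epi_regular[where s = "Idn C X"]) auto

text \<open>Regular epimorphisms, and hence their composites, can be pushed out along any arrow: the
  pushout of the coequalizer of \<open>a\<close> and \<open>b\<close> along \<open>s\<close> is the coequalizer of \<open>s \<cdot> a\<close> and
  \<open>s \<cdot> b\<close>.\<close>

lemma pushout_of_regular_epi:
  assumes coeqs: "has_coequalizers C" and e: "regular_epi C e"
    and s: "s \<in> Arr C" "Dom C s = Dom C e"
  shows "\<exists>q k. regular_epi C q \<and> weak_pushout C e s k q"
proof -
  obtain a b where ab: "is_coequalizer C a b e"
    using e unfolding regular_epi_def by blast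
  note abD = is_coequalizerD[OF ab]
  have "parallel C (s \<cdot> a) (s \<cdot> b)"
    using abD s by (simp add: parallel_def)
  then obtain q where q: "is_coequalizer C (s \<cdot> a) (s \<cdot> b) q"
    using coeqs unfolding has_coequalizers_def by blast
  note qD = is_coequalizerD[OF q]
  have qs: "Dom C q = Cod C s"
    using qD abD s by simp
  have "(q \<cdot> s) \<cdot> a = (q \<cdot> s) \<cdot> b"
    using qD(7) qD(3) qs abD(1-6) s by simp
  then obtain k where k: "k \<in> Arr C" "Dom C k = Cod C e" "Cod C k = Cod C (q \<cdot> s)" "k \<cdot> e = q \<cdot> s"
    using coequalizer_factor[OF ab, of "q \<cdot> s"] qD(3) qs abD(1-6) s by auto
  have "\<exists>l. l \<in> Arr C \<and> Dom C l = Cod C q \<and> l \<cdot> q = f"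
    if f: "f \<in> Arr C" "m \<in> Arr C" "Dom C f = Cod C s" "Dom C m = Cod C e" "f \<cdot> s = m \<cdot> e" for f m
  proof -
    have "f \<cdot> (s \<cdot> a) = (m \<cdot> e) \<cdot> a" "f \<cdot> (s \<cdot> b) = (m \<cdot> e) \<cdot> b"
      using cmp_extend[OF f(5)] f(1-4) s abD(1-6) by auto
    then have "f \<cdot> (s \<cdot> a) = f \<cdot> (s \<cdot> b)"
      using abD f(1-4) by simp
    then obtain l where "l \<in> Arr C" "Dom C l = Cod C q" "l \<cdot> q = f"
      using coequalizer_factor[OF q, of f] f(1-4) s abD(1-6) by auto
    then show ?thesis by blast
  qed
  moreover have "regular_epi C q"
    using q unfolding regular_epi_def by blast
  ultimately show ?thesis
    using k qD(3) qs s unfolding weak_pushout_def by (intro exI[of _ q] exI[of _ k]) auto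
qed

lemma pushout_of_composite:
  assumes "composite_of_regular_epis C g" "has_coequalizers C" "s \<in> Arr C" "Dom C s = Dom C g"
  shows "\<exists>q k. composite_of_regular_epis C q \<and> weak_pushout C g s k q"
  using assms
proof (induction arbitrary: s rule: composite_of_regular_epis.induct)
  case (single e)
  then obtain q k where "regular_epi C q" "weak_pushout C e s k q"
    using pushout_of_regular_epi[of e s] by auto
  then show ?case
    using composite_of_regular_epis.single[of C q] by (intro exI conjI)
next
  case (compose g e)
  have g: "g \<in> Arr C" and e: "e \<in> Arr C"
    using composite_arr[OF compose.hyps(1)] regular_epi_arr[OF compose.hyps(2)] .
  have s: "s \<in> Arr C" "Dom C s = Dom C g" and eg: "Dom C e = Cod C g"
    using compose.prems compose.hyps g e by auto
  obtain q k where q: "composite_of_regular_epis C q" and po: "weak_pushout C g s k q"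
    using compose.IH[of s] compose.prems(1) s by auto
  note k = weak_pushoutD[OF po]
  obtain q' k' where q': "regular_epi C q'" and po': "weak_pushout C e k k' q'"
    using pushout_of_regular_epi[of e k] compose.hyps compose.prems(1) k(2,4) eg by auto
  note k' = weak_pushoutD[OF po']
  have square: "(q' \<cdot> q) \<cdot> s = k' \<cdot> (e \<cdot> g)"
    using cmp_extend[OF k'(6), of g] k k'(1-5) g e eg s by simp
  have "\<exists>l. l \<in> Arr C \<and> Dom C l = Cod C q' \<and> l \<cdot> (q' \<cdot> q) = f"
    if f: "f \<in> Arr C" "m \<in> Arr C" "Dom C f = Cod C s" "Dom C m = Cod C e"
      "f \<cdot> s = m \<cdot> (e \<cdot> g)" for f m
  proof -
    have fs: "f \<cdot> s = (m \<cdot> e) \<cdot> g"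
      using f g e eg by simp
    obtain l1 where l1: "l1 \<in> Arr C" "Dom C l1 = Cod C q" "l1 \<cdot> q = f"
      by (rule weak_pushout_factor[OF po _ _ _ _ fs]) (use f(1-4) g e eg in auto)
    have "(l1 \<cdot> k) \<cdot> g = l1 \<cdot> (q \<cdot> s)"
      using l1(1,2) k g by simp
    also have "\<dots> = f \<cdot> s"
      by (rule cmp_extend[OF l1(3)]) (use l1(1,2) k(1-5) s in auto)
    finally have "(l1 \<cdot> k) \<cdot> g = (m \<cdot> e) \<cdot> g"
      using fs by simp
    then have l1k: "l1 \<cdot> k = m \<cdot> e"
      by (rule composite_cancel[OF compose.hyps(1), rotated -1])
        (use f(1-4) l1(1,2) k(1-5) g e eg in auto)
    obtain l2 where l2: "l2 \<in> Arr C" "Dom C l2 = Cod C q'" "l2 \<cdot> q' = l1"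
      by (rule weak_pushout_factor[OF po' _ _ _ _ l1k]) (use f(1-4) l1(1,2) k(1-5) in auto)
    have "l2 \<cdot> (q' \<cdot> q) = f"
      using cmp_extend[OF l2(3), of q] l1 l2(1,2) k(1-5) k'(1-5) by simp
    then show ?thesis using l2 by blast
  qed
  then have "weak_pushout C (e \<cdot> g) s k' (q' \<cdot> q)"
    unfolding weak_pushout_def using square k(1-5) k'(1-5) g e eg s
    by (simp del: cmp_right_assoc) blast
  moreover have "composite_of_regular_epis C (q' \<cdot> q)"
    using q q' k(5) k'(3) by (intro composite_of_regular_epis.compose) auto
  ultimately show ?case by blast
qed

text \<open>Pushing \<open>f \<cdot> s\<close> out along \<open>s\<close> factors \<open>f\<close> as a composite of regular epimorphisms followed by
  a split epimorphism, the section being the map parallel to \<open>s\<close> in the pushout square.\<close>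

lemma composite_left_factor:
  assumes coeqs: "has_coequalizers C"
    and f: "f \<in> Arr C" "s \<in> Arr C" "Dom C f = Cod C s"
    and fs: "composite_of_regular_epis C (f \<cdot> s)"
  shows "composite_of_regular_epis C f"
proof -
  let ?g = "f \<cdot> s"
  obtain q k where q: "composite_of_regular_epis C q" and po: "weak_pushout C ?g s k q"
    using pushout_of_composite[OF fs coeqs f(2)] f by auto
  have g: "?g \<in> Arr C" "Cod C ?g = Cod C f"
    using f by auto
  note k = weak_pushoutD[OF po]
  have fs_idn: "f \<cdot> s = Idn C (Cod C f) \<cdot> ?g"
    using f by simp
  obtain l where l: "l \<in> Arr C" "Dom C l = Cod C q" "l \<cdot> q = f"
    by (rule weak_pushout_factor[OF po _ _ _ _ fs_idn]) (use f in auto)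
  have cod: "Cod C l = Cod C f"
    using l k(1) cmp_arr(3)[of q l] by simp
  have "l \<cdot> (q \<cdot> s) = ?g"
    by (rule cmp_extend[OF l(3)]) (use l k(1-5) f in auto)
  then have "(l \<cdot> k) \<cdot> ?g = Idn C (Cod C f) \<cdot> ?g"
    using l(1,2) k f cmp_right_assoc[of ?g k l] g by (simp del: cmp_right_assoc)
  then have "l \<cdot> k = Idn C (Cod C f)"
    by (rule composite_cancel[OF fs, rotated -1]) (use f l(1,2) k(1-5) g in auto)
  then have "regular_epi C l"
    using l(1,2) k(1-5) cod by (intro split_epi_regular[of l k]) auto
  then show ?thesis
    using composite_of_regular_epis.compose[OF q, of l] l by simp
qed

end

lemma (in cfunctor) preserves_composites:
  assumes "preserves_regular_epis C D F" "composite_of_regular_epis C f"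
  shows "composite_of_regular_epis D (Fa F f)"
  using assms(2)
proof (induction rule: composite_of_regular_epis.induct)
  case (single e)
  then show ?case
    using assms(1) unfolding preserves_regular_epis_def
    by (blast intro: composite_of_regular_epis.single)
next
  case (compose f e)
  have arrs: "f \<in> Arr C" "e \<in> Arr C"
    using compose.hyps by (auto intro: source.composite_arr regular_epi_arr)
  have "composite_of_regular_epis D (Fa F e \<cdot>\<^bsub>D\<^esub> Fa F f)"
    using compose assms(1) arrs unfolding preserves_regular_epis_def
    by (intro composite_of_regular_epis.compose) auto
  then show ?case using arrs compose.hyps by simp
qed

text \<open>Transposition turns the universal property in \<open>B\<close>, tested on objects \<open>R Z\<close>, into the one in
  \<open>A\<close>, tested on \<open>Z\<close>.\<close>

lemma (in adjunction) left_adjoint_preserves_coequalizers: "preserves_coequalizers B A L"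
  unfolding preserves_coequalizers_def
proof (intro allI impI)
  fix f g e
  assume e: "is_coequalizer B f g e"
  note eD = is_coequalizerD[OF e]
  show "is_coequalizer A (Fa L f) (Fa L g) (Fa L e)"
    unfolding is_coequalizer_def
  proof (intro conjI ballI impI)
    show "parallel A (Fa L f) (Fa L g)"
      using eD by (simp add: parallel_def)
    show "Fa L e \<cdot>\<^bsub>A\<^esub> Fa L f = Fa L e \<cdot>\<^bsub>A\<^esub> Fa L g"
      using arg_cong[OF eD(7), of "Fa L"] eD(1-6) by simp
    fix h
    assume h: "h \<in> Arr A" and "Dom A h = Cod A (Fa L f) \<and> h \<cdot>\<^bsub>A\<^esub> Fa L f = h \<cdot>\<^bsub>A\<^esub> Fa L g"
    then have dom: "Dom A h = Fo L (Cod B f)" and eq: "h \<cdot>\<^bsub>A\<^esub> Fa L f = h \<cdot>\<^bsub>A\<^esub> Fa L g"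
      using eD by auto
    let ?t = "Fa R h \<cdot>\<^bsub>B\<^esub> \<eta> (Cod B f)"
    have transposed: "?t \<cdot>\<^bsub>B\<^esub> x = Fa R (h \<cdot>\<^bsub>A\<^esub> Fa L x) \<cdot>\<^bsub>B\<^esub> \<eta> (Dom B x)"
      if "x \<in> Arr B" "Cod B x = Cod B f" for x
      using that h dom eD unit_natural[of x] by simp
    have "?t \<cdot>\<^bsub>B\<^esub> f = ?t \<cdot>\<^bsub>B\<^esub> g"
      using transposed[of f] transposed[of g] eD eq by simp
    then obtain k where k: "k \<in> Arr B" "Dom B k = Cod B e" "Cod B k = Cod B ?t" "k \<cdot>\<^bsub>B\<^esub> e = ?t"
      using coequalizer_factor[OF e, of ?t] h dom eD by auto
    have cod_k: "Cod B k = Fo R (Cod A h)"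
      using k h dom eD by simp
    show "\<exists>!l. l \<in> hom A (Cod A (Fa L e)) (Cod A h) \<and> l \<cdot>\<^bsub>A\<^esub> Fa L e = h"
    proof (rule ex1I)
      let ?l = "\<epsilon> (Cod A h) \<cdot>\<^bsub>A\<^esub> Fa L k"
      have "?l \<cdot>\<^bsub>A\<^esub> Fa L e = \<epsilon> (Cod A h) \<cdot>\<^bsub>A\<^esub> Fa L (k \<cdot>\<^bsub>B\<^esub> e)"
        using h k(1,2) cod_k eD(1-6) by simp
      also have "\<dots> = h"
        using transpose_inverse[of h "Cod B f"] h dom eD unfolding k(4) by simp
      finally show "?l \<in> hom A (Cod A (Fa L e)) (Cod A h) \<and> ?l \<cdot>\<^bsub>A\<^esub> Fa L e = h"
        using h k cod_k eD by auto
      fix l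
      assume "l \<in> hom A (Cod A (Fa L e)) (Cod A h) \<and> l \<cdot>\<^bsub>A\<^esub> Fa L e = h"
      then have l: "l \<in> Arr A" "Dom A l = Fo L (Cod B e)" "Cod A l = Cod A h" "l \<cdot>\<^bsub>A\<^esub> Fa L e = h"
        using eD by auto
      have "(Fa R l \<cdot>\<^bsub>B\<^esub> \<eta> (Cod B e)) \<cdot>\<^bsub>B\<^esub> e = Fa R (l \<cdot>\<^bsub>A\<^esub> Fa L e) \<cdot>\<^bsub>B\<^esub> \<eta> (Dom B e)"
        using l(1-3) eD unit_natural[of e] by simp
      also have "\<dots> = k \<cdot>\<^bsub>B\<^esub> e"
        using l(4) k(4) eD by simp
      finally have "Fa R l \<cdot>\<^bsub>B\<^esub> \<eta> (Cod B e) = k"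
        by (rule L.source.coequalizer_epi[OF e, rotated -1]) (use l(1-3) k eD in auto)
      then show "l = ?l"
        using transpose_inverse[of l "Cod B e"] l(1-3) eD by simp
    qed
  qed (use eD in auto)
qed


section \<open>The comparison transformation is a morphism of monads\<close>

locale comparison_of_adjunctions =
  B: category B + A: category A + A': category A' +
  adj: adjunction B A L R \<eta> \<epsilon> + adj': adjunction B A' L' R' \<eta>' \<epsilon>' + F: cfunctor A A' F
  for B :: "('b, 'f) cat" and A :: "('a, 'g) cat" and A' :: "('c, 'h) cat"
    and L :: "('b, 'f, 'a, 'g) fctr" and R :: "('a, 'g, 'b, 'f) fctr"
    and \<eta> :: "'b \<Rightarrow> 'f" and \<epsilon> :: "'a \<Rightarrow> 'g"
    and L' :: "('b, 'f, 'c, 'h) fctr" and R' :: "('c, 'h, 'b, 'f) fctr"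
    and \<eta>' :: "'b \<Rightarrow> 'f" and \<epsilon>' :: "'c \<Rightarrow> 'h"
    and F :: "('a, 'g, 'c, 'h) fctr" and \<xi> :: "'a \<Rightarrow> 'f" +
  assumes FL: "fctr_eq B (F \<circ>\<^sub>F L) L'"
    and \<xi>: "\<xi> = comparison B R \<epsilon> R' \<eta>' F"
begin

lemma L'_simps [simp]:
  "X \<in> Obj B \<Longrightarrow> Fo L' X = Fo F (Fo L X)" "f \<in> Arr B \<Longrightarrow> Fa L' f = Fa F (Fa L f)"
  using FL by (simp_all add: fctr_eq_def)

lemma \<xi>_at: "\<xi> X = Fa R' (Fa F (\<epsilon> X)) \<cdot>\<^bsub>B\<^esub> \<eta>' (Fo R X)"
  by (simp add: \<xi> comparison_def whisker_defs)

lemma \<xi>_arr [simp]: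
  "X \<in> Obj A \<Longrightarrow> \<xi> X \<in> Arr B"
  "X \<in> Obj A \<Longrightarrow> Dom B (\<xi> X) = Fo R X"
  "X \<in> Obj A \<Longrightarrow> Cod B (\<xi> X) = Fo R' (Fo F X)"
  by (simp_all add: \<xi>_at)

lemma unit'_natural:
  "f \<in> Arr B \<Longrightarrow> \<eta>' (Cod B f) \<cdot>\<^bsub>B\<^esub> f = Fa R' (Fa F (Fa L f)) \<cdot>\<^bsub>B\<^esub> \<eta>' (Dom B f)"
  using adj'.unit_natural[of f] by simp

lemma counit'_natural:
  "f \<in> Arr A' \<Longrightarrow> \<epsilon>' (Cod A' f) \<cdot>\<^bsub>A'\<^esub> Fa F (Fa L (Fa R' f)) = f \<cdot>\<^bsub>A'\<^esub> \<epsilon>' (Dom A' f)"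
  using adj'.counit_natural[of f] by simp

lemma \<xi>_natural:
  assumes f: "f \<in> Arr A"
  shows "\<xi> (Cod A f) \<cdot>\<^bsub>B\<^esub> Fa R f = Fa R' (Fa F f) \<cdot>\<^bsub>B\<^esub> \<xi> (Dom A f)"
proof -
  have "\<xi> (Cod A f) \<cdot>\<^bsub>B\<^esub> Fa R f =
      Fa R' (Fa F (\<epsilon> (Cod A f))) \<cdot>\<^bsub>B\<^esub> (\<eta>' (Fo R (Cod A f)) \<cdot>\<^bsub>B\<^esub> Fa R f)"
    using f by (simp add: \<xi>_at)
  also have "\<dots> = Fa R' (Fa F (\<epsilon> (Cod A f) \<cdot>\<^bsub>A\<^esub> Fa L (Fa R f))) \<cdot>\<^bsub>B\<^esub> \<eta>' (Fo R (Dom A f))"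
    using f unit'_natural[of "Fa R f"] by simp
  also have "\<dots> = Fa R' (Fa F f) \<cdot>\<^bsub>B\<^esub> \<xi> (Dom A f)"
    using f by (simp add: adj.counit_natural \<xi>_at)
  finally show ?thesis .
qed

lemma \<xi>_nat_trans: "nat_trans A B R (R' \<circ>\<^sub>F F) \<xi>"
  by (rule nat_transI)
    (auto simp: \<xi>_natural adj.R.cfunctor_axioms
      comp_cfunctor[OF F.cfunctor_axioms adj'.R.cfunctor_axioms])

text \<open>In other words, \<open>\<xi>\<close> is the transpose of \<open>F\<epsilon>\<close> under the second adjunction.\<close>

lemma counit'_\<xi>:
  assumes "X \<in> Obj A"
  shows "\<epsilon>' (Fo F X) \<cdot>\<^bsub>A'\<^esub> Fa F (Fa L (\<xi> X)) = Fa F (\<epsilon> X)"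
  using adj'.transpose_inverse[of "Fa F (\<epsilon> X)" "Fo R X"] assms by (simp add: \<xi>_at)

lemma \<xi>_unit:
  assumes X: "X \<in> Obj B"
  shows "\<xi> (Fo L X) \<cdot>\<^bsub>B\<^esub> \<eta> X = \<eta>' X"
proof -
  have "\<xi> (Fo L X) \<cdot>\<^bsub>B\<^esub> \<eta> X =
      Fa R' (Fa F (\<epsilon> (Fo L X))) \<cdot>\<^bsub>B\<^esub> (\<eta>' (Fo R (Fo L X)) \<cdot>\<^bsub>B\<^esub> \<eta> X)"
    using X by (simp add: \<xi>_at)
  also have "\<dots> = Fa R' (Fa F (\<epsilon> (Fo L X) \<cdot>\<^bsub>A\<^esub> Fa L (\<eta> X))) \<cdot>\<^bsub>B\<^esub> \<eta>' X"
    using X unit'_natural[of "\<eta> X"] by (simp del: adj.triangle_L_at)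
  also have "\<dots> = \<eta>' X"
    using X by simp
  finally show ?thesis .
qed

lemma \<xi>_mult:
  assumes X: "X \<in> Obj B"
  shows "Fa R' (\<epsilon>' (Fo L' X)) \<cdot>\<^bsub>B\<^esub>
      (\<xi> (Fo L (Fo R' (Fo L' X))) \<cdot>\<^bsub>B\<^esub> Fa R (Fa L (\<xi> (Fo L X)))) =
    \<xi> (Fo L X) \<cdot>\<^bsub>B\<^esub> Fa R (\<epsilon> (Fo L X))"
proof -
  let ?Y = "Fo L X"
  have "Fa R' (\<epsilon>' (Fo F ?Y)) \<cdot>\<^bsub>B\<^esub>
      (\<xi> (Fo L (Fo R' (Fo F ?Y))) \<cdot>\<^bsub>B\<^esub> Fa R (Fa L (\<xi> ?Y))) =
    Fa R' (\<epsilon>' (Fo F ?Y)) \<cdot>\<^bsub>B\<^esub> (Fa R' (Fa F (Fa L (\<xi> ?Y))) \<cdot>\<^bsub>B\<^esub> \<xi> (Fo L (Fo R ?Y)))"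
    using X \<xi>_natural[of "Fa L (\<xi> ?Y)"] by simp
  also have "\<dots> = Fa R' (\<epsilon>' (Fo F ?Y) \<cdot>\<^bsub>A'\<^esub> Fa F (Fa L (\<xi> ?Y))) \<cdot>\<^bsub>B\<^esub> \<xi> (Fo L (Fo R ?Y))"
    using X by simp
  also have "\<dots> = Fa R' (Fa F (\<epsilon> ?Y)) \<cdot>\<^bsub>B\<^esub> \<xi> (Fo L (Fo R ?Y))"
    using X by (simp add: counit'_\<xi>)
  also have "\<dots> = \<xi> ?Y \<cdot>\<^bsub>B\<^esub> Fa R (\<epsilon> ?Y)"
    using X \<xi>_natural[of "\<epsilon> ?Y"] by simp
  finally show ?thesis using X by simp
qed

lemma \<xi>L_monad_morphism:
  "monad_morphism B (R \<circ>\<^sub>F L) (R \<rhd> (\<epsilon> \<lhd> L)) \<eta> (R' \<circ>\<^sub>F L') (R' \<rhd> (\<epsilon>' \<lhd> L')) \<eta>' (\<xi> \<lhd> L)"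
proof -
  have "nat_trans B B (R \<circ>\<^sub>F L) (R' \<circ>\<^sub>F L') (\<xi> \<lhd> L)"
  proof (rule nat_transI)
    fix f
    assume "f \<in> Arr B"
    then show "(\<xi> \<lhd> L) (Cod B f) \<cdot>\<^bsub>B\<^esub> Fa (R \<circ>\<^sub>F L) f = Fa (R' \<circ>\<^sub>F L') f \<cdot>\<^bsub>B\<^esub> (\<xi> \<lhd> L) (Dom B f)"
      using \<xi>_natural[of "Fa L f"] by (simp add: whisker_defs)
  qed (auto simp: whisker_defs adj.unit.right.cfunctor_axioms adj'.unit.right.cfunctor_axioms)
  then show ?thesis
    using \<xi>_mult
    unfolding monad_morphism_def monad_morphism_axioms_def
    by (intro conjI adj.induced_monad adj'.induced_monad) (auto simp: whisker_defs \<xi>_unit)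
qed

end


section \<open>The stages of the adjoint decomposition\<close>

text \<open>The part of the structure of a stage that the recursion for the categories \<open>B\<^sub>[\<^sub>n\<^sub>]\<close> and
  the functors \<open>L\<^sub>[\<^sub>n\<^sub>]\<close> relies on. The condition \<open>underlying_unit\<close> says that \<open>\<pi>\<^sub>[\<^sub>n\<^sub>]\<close> is the
  transpose of \<open>U\<^sub>[\<^sub>n\<^sub>]\<eta>\<^sub>[\<^sub>n\<^sub>]\<close>. It passes to the next stage by the last two equations, which hold
  for the underlying total maps of HOL, so that \<open>U\<^sub>[\<^sub>n\<^sub>]\<close> can be applied to the recursion for the unit
  before \<open>\<eta>\<^sub>[\<^sub>n\<^sub>]\<close> and \<open>R\<^sub>[\<^sub>n\<^sub>]\<close> are known to land in \<open>B\<^sub>[\<^sub>n\<^sub>]\<close>.\<close>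

locale decomposition_stage =
  B: category B + A: category A + stage: category "BB S" +
  adj: adjunction B A L R \<eta> \<epsilon> +
  UU: cfunctor "BB S" B "UU S" + LL: cfunctor "BB S" A "LL S" +
  ppi: nat_trans "BB S" A "L \<circ>\<^sub>F UU S" "LL S" "ppi S"
  for B :: "('b, 'f) cat" and A :: "('a, 'g) cat"
    and L :: "('b, 'f, 'a, 'g) fctr" and R :: "('a, 'g, 'b, 'f) fctr"
    and \<eta> :: "'b \<Rightarrow> 'f" and \<epsilon> :: "'a \<Rightarrow> 'g"
    and S :: "('b, 'f, 'a, 'g) stage" +
  assumes underlying_unit: "P \<in> Obj (BB S) \<Longrightarrow>
    Fa (UU S) (unitt S P) = Fa R (ppi S P) \<cdot>\<^bsub>B\<^esub> \<eta> (Fo (UU S) P)"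
    and UU_cmp: "Fa (UU S) (g \<cdot>\<^bsub>BB S\<^esub> f) = Fa (UU S) g \<cdot>\<^bsub>B\<^esub> Fa (UU S) f"
    and UU_RR: "Fa (UU S) (Fa (RR S) h) = Fa R h"

lemma base_simps [simp]:
  "Obj (base_cat C) = OBase ` Obj C" "Arr (base_cat C) = ABase ` Arr C"
  "Dom (base_cat C) f = OBase (Dom C (abase f))" "Cod (base_cat C) f = OBase (Cod C (abase f))"
  "Idn (base_cat C) X = ABase (Idn C (obase X))"
  "g \<cdot>\<^bsub>base_cat C\<^esub> f = ABase (abase g \<cdot>\<^bsub>C\<^esub> abase f)"
  "Fo wrap_fctr Y = OBase Y" "Fa wrap_fctr h = ABase h"
  "Fo unwrap_fctr X = obase X" "Fa unwrap_fctr f = abase f"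
  by (simp_all add: base_cat_def wrap_fctr_def unwrap_fctr_def)

lemma (in category) base_category: "category (base_cat C)"
  by (rule category.intro) auto

lemma (in adjunction) base_decomposition_stage:
  "decomposition_stage B A L R \<eta> \<epsilon> (base_stage B A L R \<eta> \<epsilon>)"
proof -
  let ?B0 = "base_cat B"
  have U: "cfunctor ?B0 B unwrap_fctr"
    by (rule cfunctorI[OF L.source.base_category L.source.category_axioms]) auto
  have LU: "cfunctor ?B0 A (L \<circ>\<^sub>F unwrap_fctr)"
    by (rule comp_cfunctor[OF U L.cfunctor_axioms])
  have "nat_trans ?B0 A (L \<circ>\<^sub>F unwrap_fctr) (L \<circ>\<^sub>F unwrap_fctr) (id_nat A (L \<circ>\<^sub>F unwrap_fctr))"
    by (rule nat_transI) (auto simp: LU id_nat_def)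
  then show ?thesis
    using U LU adjunction_axioms L.source.category_axioms L.target.category_axioms
      L.source.base_category
    by (auto simp: decomposition_stage_def decomposition_stage_axioms_def base_stage_def id_nat_def)
qed

locale decomposition_step = decomposition_stage B A L R \<eta> \<epsilon> S
  for B :: "('b, 'f) cat" and A :: "('a, 'g) cat"
    and L :: "('b, 'f, 'a, 'g) fctr" and R :: "('a, 'g, 'b, 'f) fctr"
    and \<eta> :: "'b \<Rightarrow> 'f" and \<epsilon> :: "'a \<Rightarrow> 'g"
    and S :: "('b, 'f, 'a, 'g) stage" +
  fixes q :: "'g \<Rightarrow> 'g \<Rightarrow> 'g"
  assumes choice: "coequalizer_choice A q"
begin

abbreviation "NB \<equiv> next_cat B R S"
abbreviation "NL \<equiv> next_L A L \<epsilon> q S"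
abbreviation "\<pi> \<equiv> pi_step A L \<epsilon> q S"

lemma next_objD:
  assumes "P \<in> next_obj B R S"
  shows "opre P \<in> Obj (BB S)" "omor P \<in> Arr B"
    "Dom B (omor P) = Fo R (Fo (LL S) (opre P))" "Cod B (omor P) = Fo (UU S) (opre P)"
  using assms by (auto simp: next_obj_def)

lemma next_arrD:
  assumes "f \<in> Arr NB"
  shows "asrc f \<in> next_obj B R S" "atgt f \<in> next_obj B R S" "apre f \<in> Arr (BB S)"
    "Dom (BB S) (apre f) = opre (asrc f)" "Cod (BB S) (apre f) = opre (atgt f)"
    "Fa (UU S) (apre f) \<cdot>\<^bsub>B\<^esub> omor (asrc f) = omor (atgt f) \<cdot>\<^bsub>B\<^esub> Fa R (Fa (LL S) (apre f))"
    "f = APair (asrc f) (apre f) (atgt f)"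
  using assms by (auto simp: next_cat_def)

lemma next_arrI:
  assumes "P \<in> next_obj B R S" "Q \<in> next_obj B R S" "f \<in> Arr (BB S)"
    "Dom (BB S) f = opre P" "Cod (BB S) f = opre Q"
    "Fa (UU S) f \<cdot>\<^bsub>B\<^esub> omor P = omor Q \<cdot>\<^bsub>B\<^esub> Fa R (Fa (LL S) f)"
  shows "APair P f Q \<in> Arr NB"
  using assms by (auto simp: next_cat_def)

lemma next_cat_simps [simp]:
  "Obj NB = next_obj B R S" "Dom NB = asrc" "Cod NB = atgt"
  "Idn NB P = APair P (Idn (BB S) (opre P)) P"
  "g \<cdot>\<^bsub>NB\<^esub> f = APair (asrc f) (apre g \<cdot>\<^bsub>BB S\<^esub> apre f) (atgt g)"
  by (simp_all add: next_cat_def)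

lemma next_category: "category NB"
proof (unfold_locales, goal_cases)
  case (3 P)
  then show ?case using next_objD[of P] by (auto intro!: next_arrI)
next
  case (4 f X Y g Z)
  then have f: "f \<in> Arr NB" and g: "g \<in> Arr NB" and fg: "asrc g = atgt f" "asrc f = X" "atgt g = Z"
    by auto
  note fD = next_arrD[OF f] next_objD[OF next_arrD(1)[OF f]] next_objD[OF next_arrD(2)[OF f]]
  note gD = next_arrD[OF g] next_objD[OF next_arrD(2)[OF g]]
  have "Fa (UU S) (apre g) \<cdot>\<^bsub>B\<^esub> (Fa (UU S) (apre f) \<cdot>\<^bsub>B\<^esub> omor (asrc f)) =
      (Fa (UU S) (apre g) \<cdot>\<^bsub>B\<^esub> omor (atgt f)) \<cdot>\<^bsub>B\<^esub> Fa R (Fa (LL S) (apre f))"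
    using fD gD(1-5,8-) fg by simp
  also have "\<dots> = omor (atgt g) \<cdot>\<^bsub>B\<^esub> (Fa R (Fa (LL S) (apre g)) \<cdot>\<^bsub>B\<^esub> Fa R (Fa (LL S) (apre f)))"
    using fD(1-5,8-) gD fg by simp
  finally have "APair (asrc f) (apre g \<cdot>\<^bsub>BB S\<^esub> apre f) (atgt g) \<in> Arr NB"
    using fD(1-5,8-) gD(1-5,8-) fg by (intro next_arrI) auto
  then show ?case using fg by simp
next
  case (5 f X Y)
  then show ?case using next_arrD[of f] by simp
next
  case (6 f X Y)
  then show ?case using next_arrD[of f] by simp
next
  case (7 f W X g Y h Z)
  then show ?case using next_arrD[of f] next_arrD[of g] next_arrD[of h] by simp
qed (auto dest: next_arrD)

lemma forget_cfunctor: "cfunctor NB (BB S) forget"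
  by (rule cfunctorI)
    (auto simp: next_category stage.category_axioms forget_def dest: next_arrD next_objD)

lemma \<pi>_coequalizer:
  assumes P: "P \<in> next_obj B R S"
  shows "is_coequalizer A (ppi S (opre P) \<cdot>\<^bsub>A\<^esub> Fa L (omor P)) (\<epsilon> (Fo (LL S) (opre P))) (\<pi> P)"
proof -
  have "parallel A (ppi S (opre P) \<cdot>\<^bsub>A\<^esub> Fa L (omor P)) (\<epsilon> (Fo (LL S) (opre P)))"
    using next_objD[OF P] by (simp add: parallel_def)
  then show ?thesis
    using choice by (simp add: coequalizer_choice_def pi_step_def)
qed

lemma \<pi>_arr [simp]:
  assumes "P \<in> next_obj B R S"
  shows "\<pi> P \<in> Arr A" "Dom A (\<pi> P) = Fo (LL S) (opre P)" "Cod A (\<pi> P) = Fo NL P"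
  using is_coequalizerD[OF \<pi>_coequalizer[OF assms]] next_objD[OF assms]
  by (simp_all add: next_L_def)

lemma NL_arr:
  assumes f: "f \<in> Arr NB"
  shows "Fa NL f \<in> Arr A" "Dom A (Fa NL f) = Fo NL (asrc f)" "Cod A (Fa NL f) = Fo NL (atgt f)"
    "Fa NL f \<cdot>\<^bsub>A\<^esub> \<pi> (asrc f) = \<pi> (atgt f) \<cdot>\<^bsub>A\<^esub> Fa (LL S) (apre f)"
proof -
  let ?P = "asrc f" and ?Q = "atgt f" and ?f = "apre f"
  note fD = next_arrD[OF f]
  note PD = next_objD[OF fD(1)] and QD = next_objD[OF fD(2)]
  note coeq = \<pi>_coequalizer[OF fD(1)] and coeqQ = is_coequalizerD(7)[OF \<pi>_coequalizer[OF fD(2)]]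
  let ?h = "\<pi> ?Q \<cdot>\<^bsub>A\<^esub> Fa (LL S) ?f"
  have "Fa (LL S) ?f \<cdot>\<^bsub>A\<^esub> (ppi S (opre ?P) \<cdot>\<^bsub>A\<^esub> Fa L (omor ?P)) =
      (ppi S (opre ?Q) \<cdot>\<^bsub>A\<^esub> Fa L (Fa (UU S) ?f)) \<cdot>\<^bsub>A\<^esub> Fa L (omor ?P)"
    by (rule A.cmp_extend) (use fD(1-5) PD QD ppi.natural[of ?f "opre ?P" "opre ?Q"] in auto)
  also have "\<dots> = ppi S (opre ?Q) \<cdot>\<^bsub>A\<^esub> Fa L (Fa (UU S) ?f \<cdot>\<^bsub>B\<^esub> omor ?P)"
    using fD(1-5) PD QD by simp
  also have "\<dots> = (ppi S (opre ?Q) \<cdot>\<^bsub>A\<^esub> Fa L (omor ?Q)) \<cdot>\<^bsub>A\<^esub> Fa L (Fa R (Fa (LL S) ?f))"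
    unfolding fD(6) using fD(1-5) PD QD by simp
  finally have "?h \<cdot>\<^bsub>A\<^esub> (ppi S (opre ?P) \<cdot>\<^bsub>A\<^esub> Fa L (omor ?P)) =
      (\<pi> ?Q \<cdot>\<^bsub>A\<^esub> (ppi S (opre ?Q) \<cdot>\<^bsub>A\<^esub> Fa L (omor ?Q))) \<cdot>\<^bsub>A\<^esub> Fa L (Fa R (Fa (LL S) ?f))"
    using fD(1-5) PD QD by simp
  also have "\<dots> = \<pi> ?Q \<cdot>\<^bsub>A\<^esub> (\<epsilon> (Fo (LL S) (opre ?Q)) \<cdot>\<^bsub>A\<^esub> Fa L (Fa R (Fa (LL S) ?f)))"
    unfolding coeqQ using fD(1-5) PD QD by simp
  also have "\<dots> = ?h \<cdot>\<^bsub>A\<^esub> \<epsilon> (Fo (LL S) (opre ?P))"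
    using fD(1-5) PD QD adj.counit_natural[of "Fa (LL S) ?f"] by simp
  finally have "\<exists>!k. k \<in> hom A (Cod A (\<pi> ?P)) (Cod A ?h) \<and> k \<cdot>\<^bsub>A\<^esub> \<pi> ?P = ?h"
    using fD(1-5) PD QD by (intro coequalizer_factors_uniquely[OF coeq]) auto
  then have "\<exists>!k. k \<in> hom A (Cod A (\<pi> ?P)) (Cod A (\<pi> ?Q)) \<and> k \<cdot>\<^bsub>A\<^esub> \<pi> ?P = ?h"
    using fD(1-5) QD by simp
  from theI'[OF this]
  have "Fa NL f \<in> hom A (Cod A (\<pi> ?P)) (Cod A (\<pi> ?Q)) \<and> Fa NL f \<cdot>\<^bsub>A\<^esub> \<pi> ?P = ?h"
    by (simp add: next_L_def)
  then show "Fa NL f \<in> Arr A" "Dom A (Fa NL f) = Fo NL ?P" "Cod A (Fa NL f) = Fo NL ?Q"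
      "Fa NL f \<cdot>\<^bsub>A\<^esub> \<pi> ?P = ?h"
    using fD(1,2) by simp_all
qed

text \<open>The defining equation of \<open>Fa NL f\<close> determines it, because \<open>\<pi>\<close> consists of coequalizers.\<close>

lemma NL_unique:
  assumes f: "f \<in> Arr NB" and h: "h \<in> Arr A" "Dom A h = Fo NL (asrc f)"
    and eq: "h \<cdot>\<^bsub>A\<^esub> \<pi> (asrc f) = \<pi> (atgt f) \<cdot>\<^bsub>A\<^esub> Fa (LL S) (apre f)"
  shows "Fa NL f = h"
  by (rule A.coequalizer_epi[OF \<pi>_coequalizer[OF next_arrD(1)[OF f]]])
    (use NL_arr[OF f] next_arrD[OF f] h eq in auto)

lemma next_L_cfunctor: "cfunctor NB A NL"
proof (rule cfunctorI)
  fix P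
  assume P: "P \<in> Obj NB"
  show "Fo NL P \<in> Obj A"
    using P \<pi>_arr[of P] A.arr_obj(2)[of "\<pi> P"] by simp
  show "Fa NL (Idn NB P) = Idn A (Fo NL P)"
    using P category.idn_arr(1)[OF next_category P] next_objD[of P] \<pi>_arr[of P]
      A.arr_obj(2)[of "\<pi> P"] by (intro NL_unique) auto
next
  fix f g
  assume fg: "f \<in> Arr NB" "g \<in> Arr NB" "Dom NB g = Cod NB f"
  note f = next_arrD[OF fg(1)] and g = next_arrD[OF fg(2)]
  note Nf = NL_arr[OF fg(1)] and Ng = NL_arr[OF fg(2)]
  have eq: "asrc g = atgt f"
    using fg by simp
  have "Fa NL g \<cdot>\<^bsub>A\<^esub> (Fa NL f \<cdot>\<^bsub>A\<^esub> \<pi> (asrc f)) =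
      (Fa NL g \<cdot>\<^bsub>A\<^esub> \<pi> (atgt f)) \<cdot>\<^bsub>A\<^esub> Fa (LL S) (apre f)"
    unfolding Nf(4) using Nf(1-3) Ng(1-3) f(1-5) g(1-5) eq by simp
  also have "\<dots> = \<pi> (atgt g) \<cdot>\<^bsub>A\<^esub> (Fa (LL S) (apre g) \<cdot>\<^bsub>A\<^esub> Fa (LL S) (apre f))"
    using Ng(4) f(1-5) g(1-5) eq next_objD[OF f(1)] next_objD[OF f(2)] next_objD[OF g(2)] by simp
  finally have eq': "(Fa NL g \<cdot>\<^bsub>A\<^esub> Fa NL f) \<cdot>\<^bsub>A\<^esub> \<pi> (asrc f) =
      \<pi> (atgt g) \<cdot>\<^bsub>A\<^esub> Fa (LL S) (apre g \<cdot>\<^bsub>BB S\<^esub> apre f)"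
    using Nf(1-3) Ng(1-3) f(1-5) g(1-5) eq by simp
  show "Fa NL (g \<cdot>\<^bsub>NB\<^esub> f) = Fa NL g \<cdot>\<^bsub>A\<^esub> Fa NL f"
    by (rule NL_unique)
      (use eq' Nf(1-3) Ng(1-3) eq category.cmp_arr(1)[OF next_category fg] in auto)
qed (auto simp: next_category A.category_axioms NL_arr)

lemma next_decomposition_stage:
  "decomposition_stage B A L R \<eta> \<epsilon> (next_stage B A L R \<epsilon> q S)"
proof -
  let ?N = "next_stage B A L R \<epsilon> q S"
  have stage [simp]: "BB ?N = NB" "UU ?N = UU S \<circ>\<^sub>F forget" "LL ?N = NL"
      "ppi ?N = vcomp A \<pi> (ppi S \<lhd> forget)" "unitt ?N = next_unit A L R \<epsilon> q S"
    by (simp_all add: next_stage_def)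
  have U: "cfunctor NB B (UU S \<circ>\<^sub>F forget)"
    by (rule comp_cfunctor[OF forget_cfunctor UU.cfunctor_axioms])
  have "nat_trans NB A (L \<circ>\<^sub>F UU S \<circ>\<^sub>F forget) NL (vcomp A \<pi> (ppi S \<lhd> forget))"
  proof (rule nat_transI)
    fix P
    assume "P \<in> Obj NB"
    then show "vcomp A \<pi> (ppi S \<lhd> forget) P \<in> Arr A \<and>
        Dom A (vcomp A \<pi> (ppi S \<lhd> forget) P) = Fo (L \<circ>\<^sub>F UU S \<circ>\<^sub>F forget) P \<and>
        Cod A (vcomp A \<pi> (ppi S \<lhd> forget) P) = Fo NL P"
      using next_objD[of P] by (simp add: whisker_defs forget_def)
  next
    fix f
    assume f: "f \<in> Arr NB"
    note fD = next_arrD[OF f]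
    note PD = next_objD[OF fD(1)] and QD = next_objD[OF fD(2)]
    have "Fa NL f \<cdot>\<^bsub>A\<^esub> (\<pi> (asrc f) \<cdot>\<^bsub>A\<^esub> ppi S (opre (asrc f))) =
        (\<pi> (atgt f) \<cdot>\<^bsub>A\<^esub> Fa (LL S) (apre f)) \<cdot>\<^bsub>A\<^esub> ppi S (opre (asrc f))"
      by (rule A.cmp_extend[OF NL_arr(4)[OF f]]) (use NL_arr(1-3)[OF f] fD(1-5) PD in auto)
    also have "\<dots> = (\<pi> (atgt f) \<cdot>\<^bsub>A\<^esub> ppi S (opre (atgt f))) \<cdot>\<^bsub>A\<^esub> Fa L (Fa (UU S) (apre f))"
      using ppi.natural[of "apre f" "opre (asrc f)" "opre (atgt f)"] fD(1-5) PD QD by simp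
    finally show "vcomp A \<pi> (ppi S \<lhd> forget) (Cod NB f) \<cdot>\<^bsub>A\<^esub> Fa (L \<circ>\<^sub>F UU S \<circ>\<^sub>F forget) f =
        Fa NL f \<cdot>\<^bsub>A\<^esub> vcomp A \<pi> (ppi S \<lhd> forget) (Dom NB f)"
      by (simp add: whisker_defs forget_def)
  qed (auto simp: next_L_cfunctor comp_cfunctor[OF U adj.L.cfunctor_axioms])
  moreover have "Fa (UU ?N) (unitt ?N P) = Fa R (ppi ?N P) \<cdot>\<^bsub>B\<^esub> \<eta> (Fo (UU ?N) P)"
    if P: "P \<in> Obj NB" for P
  proof -
    have P': "P \<in> next_obj B R S"
      using P by simp
    note PD = next_objD[OF P']
    have "Fa (UU ?N) (unitt ?N P) = Fa R (\<pi> P) \<cdot>\<^bsub>B\<^esub> (Fa R (ppi S (opre P)) \<cdot>\<^bsub>B\<^esub> \<eta> (Fo (UU S) (opre P)))"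
      using underlying_unit[OF PD(1)] by (simp add: next_unit_def forget_def UU_cmp UU_RR)
    also have "\<dots> = Fa R (ppi ?N P) \<cdot>\<^bsub>B\<^esub> \<eta> (Fo (UU ?N) P)"
      using PD P' by (simp add: whisker_defs forget_def)
    finally show ?thesis .
  qed
  moreover have "Fa (UU ?N) (g \<cdot>\<^bsub>NB\<^esub> f) = Fa (UU ?N) g \<cdot>\<^bsub>B\<^esub> Fa (UU ?N) f"
      "Fa (UU ?N) (Fa (RR ?N) h) = Fa R h" for g f h
    by (simp_all add: forget_def UU_cmp UU_RR next_stage_def next_R_def Let_def)
  ultimately show ?thesis
    using next_category next_L_cfunctor U
    by (auto simp: decomposition_stage_def decomposition_stage_axioms_def
        adj.adjunction_axioms B.category_axioms A.category_axioms)
qed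

end


section \<open>Lifting the augmentation through the stages\<close>

locale augmented_comparison =
  comparison_of_adjunctions B A A' L R \<eta> \<epsilon> L' R' \<eta>' \<epsilon>' F \<xi> +
  aug': augmentation B "R' \<circ>\<^sub>F L'" "R' \<rhd> (\<epsilon>' \<lhd> L')" \<eta>' \<gamma>'
  for B :: "('b, 'f) cat" and A :: "('a, 'g) cat" and A' :: "('c, 'h) cat"
    and L :: "('b, 'f, 'a, 'g) fctr" and R :: "('a, 'g, 'b, 'f) fctr"
    and \<eta> :: "'b \<Rightarrow> 'f" and \<epsilon> :: "'a \<Rightarrow> 'g"
    and L' :: "('b, 'f, 'c, 'h) fctr" and R' :: "('c, 'h, 'b, 'f) fctr"
    and \<eta>' :: "'b \<Rightarrow> 'f" and \<epsilon>' :: "'c \<Rightarrow> 'h"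
    and F :: "('a, 'g, 'c, 'h) fctr" and \<xi> :: "'a \<Rightarrow> 'f"
    and \<gamma>' :: "'b \<Rightarrow> 'f" +
  assumes coequalizers: "has_coequalizers A"
    and F_coequalizers: "preserves_coequalizers A A' F"
    and R'_twisted: "preserves_idempotent_twisted_coequalizers A' B R'"
    and R'_regular_epis: "preserves_regular_epis A' B R'"
begin

lemma \<gamma>'_arr [simp]:
  "X \<in> Obj B \<Longrightarrow> \<gamma>' X \<in> Arr B"
  "X \<in> Obj B \<Longrightarrow> Dom B (\<gamma>' X) = Fo R' (Fo F (Fo L X))"
  "X \<in> Obj B \<Longrightarrow> Cod B (\<gamma>' X) = X"
  using aug'.nat.component_arr[of X] by simp_all

lemma \<gamma>'_unit: "X \<in> Obj B \<Longrightarrow> \<gamma>' X \<cdot>\<^bsub>B\<^esub> \<eta>' X = Idn B X"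
  using aug'.aug_unit by (auto simp: whisker_defs)

lemma \<gamma>'_mult:
  assumes "X \<in> Obj B"
  shows "\<gamma>' X \<cdot>\<^bsub>B\<^esub> Fa R' (Fa F (Fa L (\<gamma>' X))) = \<gamma>' X \<cdot>\<^bsub>B\<^esub> Fa R' (\<epsilon>' (Fo F (Fo L X)))"
  using aug'.aug_mult assms by (auto simp: whisker_defs)

end

text \<open>A stage together with a section \<open>\<Gamma>\<close> of its forgetful functor and an extension \<open>\<delta>\<close> of the
  augmentation \<open>\<gamma>'\<close> along \<open>R'F\<pi>\<^sub>[\<^sub>n\<^sub>]\<Gamma>\<close>. The transformation \<open>\<gamma>\<^sub>[\<^sub>n\<^sub>]\<close> is
  \<open>\<delta> \<circ> \<xi>L\<^sub>[\<^sub>n\<^sub>]\<Gamma>\<close>; induction runs over \<open>\<delta>\<close> because the preservation properties of \<open>R'\<close> and \<open>F\<close>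
  allow \<open>\<delta>\<close> to be factored through \<open>R'F\<close> of the next coequalizer.\<close>

locale lifted_augmentation =
  augmented_comparison B A A' L R \<eta> \<epsilon> L' R' \<eta>' \<epsilon>' F \<xi> \<gamma>' +
  decomposition_step B A L R \<eta> \<epsilon> S q +
  \<Gamma>: cfunctor B "BB S" \<Gamma> +
  lift: nat_trans B B "R' \<circ>\<^sub>F F \<circ>\<^sub>F LL S \<circ>\<^sub>F \<Gamma>" id_fctr \<delta>
  for B :: "('b, 'f) cat" and A :: "('a, 'g) cat" and A' :: "('c, 'h) cat"
    and L :: "('b, 'f, 'a, 'g) fctr" and R :: "('a, 'g, 'b, 'f) fctr"
    and \<eta> :: "'b \<Rightarrow> 'f" and \<epsilon> :: "'a \<Rightarrow> 'g"
    and L' :: "('b, 'f, 'c, 'h) fctr" and R' :: "('c, 'h, 'b, 'f) fctr"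
    and \<eta>' :: "'b \<Rightarrow> 'f" and \<epsilon>' :: "'c \<Rightarrow> 'h"
    and F :: "('a, 'g, 'c, 'h) fctr" and \<xi> :: "'a \<Rightarrow> 'f"
    and \<gamma>' :: "'b \<Rightarrow> 'f" and q :: "'g \<Rightarrow> 'g \<Rightarrow> 'g"
    and S :: "('b, 'f, 'a, 'g) stage"
    and \<Gamma> :: "('b, 'f, ('b, 'f) tobj, ('b, 'f) tarr) fctr" and \<delta> :: "'b \<Rightarrow> 'f" +
  assumes UU_\<Gamma>_obj [simp]: "X \<in> Obj B \<Longrightarrow> Fo (UU S) (Fo \<Gamma> X) = X"
    and UU_\<Gamma>_arr [simp]: "f \<in> Arr B \<Longrightarrow> Fa (UU S) (Fa \<Gamma> f) = f"
    and \<delta>_extends: "X \<in> Obj B \<Longrightarrow> \<delta> X \<cdot>\<^bsub>B\<^esub> Fa R' (Fa F (ppi S (Fo \<Gamma> X))) = \<gamma>' X"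
    and ppi_composite: "X \<in> Obj B \<Longrightarrow> composite_of_regular_epis A (ppi S (Fo \<Gamma> X))"

text \<open>The transformation \<open>\<gamma>\<^sub>[\<^sub>n\<^sub>]\<close>.\<close>

definition stage_augmentation ::
  "('b, 'f) cat \<Rightarrow> ('a \<Rightarrow> 'f) \<Rightarrow> ('b, 'f, 'a, 'g) stage \<Rightarrow>
    ('b, 'f, ('b, 'f) tobj, ('b, 'f) tarr) fctr \<Rightarrow> ('b \<Rightarrow> 'f) \<Rightarrow> 'b \<Rightarrow> 'f" where
  "stage_augmentation B \<xi> S \<Gamma> \<delta> = vcomp B \<delta> (\<xi> \<lhd> (LL S \<circ>\<^sub>F \<Gamma>))"

text \<open>The lift of \<open>\<Gamma>\<close> along the forgetful functor that equips \<open>\<Gamma> X\<close> with the structure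
  arrow \<open>g X\<close>; naturality of \<open>g\<close> is what makes it a functor into the next stage.\<close>

definition pair_fctr ::
  "('b, 'f) cat \<Rightarrow> ('b, 'f, ('b, 'f) tobj, ('b, 'f) tarr) fctr \<Rightarrow> ('b \<Rightarrow> 'f) \<Rightarrow>
    ('b, 'f, ('b, 'f) tobj, ('b, 'f) tarr) fctr" where
  "pair_fctr B \<Gamma> g =
     \<lparr>Fo = (\<lambda>X. OPair (Fo \<Gamma> X) (g X)),
      Fa = (\<lambda>f. APair (OPair (Fo \<Gamma> (Dom B f)) (g (Dom B f))) (Fa \<Gamma> f)
                  (OPair (Fo \<Gamma> (Cod B f)) (g (Cod B f))))\<rparr>"

lemma pair_fctr_simps [simp]:
  "Fo (pair_fctr B \<Gamma> g) X = OPair (Fo \<Gamma> X) (g X)"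
  "Fa (pair_fctr B \<Gamma> g) f = APair (OPair (Fo \<Gamma> (Dom B f)) (g (Dom B f))) (Fa \<Gamma> f)
      (OPair (Fo \<Gamma> (Cod B f)) (g (Cod B f)))"
  by (simp_all add: pair_fctr_def)

context lifted_augmentation
begin

abbreviation "\<gamma>S \<equiv> stage_augmentation B \<xi> S \<Gamma> \<delta>"
abbreviation "LS X \<equiv> Fo (LL S) (Fo \<Gamma> X)"
abbreviation "p X \<equiv> ppi S (Fo \<Gamma> X)"

lemma \<gamma>S_at: "\<gamma>S X = \<delta> X \<cdot>\<^bsub>B\<^esub> \<xi> (LS X)"
  by (simp add: stage_augmentation_def whisker_defs)

lemma \<delta>_arr [simp]:
  "X \<in> Obj B \<Longrightarrow> \<delta> X \<in> Arr B"
  "X \<in> Obj B \<Longrightarrow> Dom B (\<delta> X) = Fo R' (Fo F (LS X))"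
  "X \<in> Obj B \<Longrightarrow> Cod B (\<delta> X) = X"
  using lift.component_arr[of X] by simp_all

lemma \<gamma>S_arr [simp]:
  "X \<in> Obj B \<Longrightarrow> \<gamma>S X \<in> Arr B"
  "X \<in> Obj B \<Longrightarrow> Dom B (\<gamma>S X) = Fo R (LS X)"
  "X \<in> Obj B \<Longrightarrow> Cod B (\<gamma>S X) = X"
  by (simp_all add: \<gamma>S_at)

lemma p_arr [simp]:
  "X \<in> Obj B \<Longrightarrow> p X \<in> Arr A"
  "X \<in> Obj B \<Longrightarrow> Dom A (p X) = Fo L X"
  "X \<in> Obj B \<Longrightarrow> Cod A (p X) = LS X"
  using ppi.component_arr[of "Fo \<Gamma> X"] by simp_all

lemma \<delta>_natural:
  "f \<in> Arr B \<Longrightarrow>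
    \<delta> (Cod B f) \<cdot>\<^bsub>B\<^esub> Fa R' (Fa F (Fa (LL S) (Fa \<Gamma> f))) = f \<cdot>\<^bsub>B\<^esub> \<delta> (Dom B f)"
  using lift.natural[of f] by simp

lemma \<gamma>S_natural:
  assumes f: "f \<in> Arr B"
  shows "\<gamma>S (Cod B f) \<cdot>\<^bsub>B\<^esub> Fa R (Fa (LL S) (Fa \<Gamma> f)) = f \<cdot>\<^bsub>B\<^esub> \<gamma>S (Dom B f)"
proof -
  let ?g = "Fa (LL S) (Fa \<Gamma> f)"
  have "\<gamma>S (Cod B f) \<cdot>\<^bsub>B\<^esub> Fa R ?g = \<delta> (Cod B f) \<cdot>\<^bsub>B\<^esub> (Fa R' (Fa F ?g) \<cdot>\<^bsub>B\<^esub> \<xi> (LS (Dom B f)))"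
    using f \<xi>_natural[of ?g] by (simp add: \<gamma>S_at)
  also have "\<dots> = (f \<cdot>\<^bsub>B\<^esub> \<delta> (Dom B f)) \<cdot>\<^bsub>B\<^esub> \<xi> (LS (Dom B f))"
    by (rule B.cmp_extend[OF \<delta>_natural]) (use f in auto)
  finally show ?thesis using f by (simp add: \<gamma>S_at)
qed

lemma \<gamma>S_nat_trans: "nat_trans B B (R \<circ>\<^sub>F LL S \<circ>\<^sub>F \<Gamma>) id_fctr \<gamma>S"
  by (rule nat_transI)
    (auto simp: \<gamma>S_natural id_cfunctor[OF B.category_axioms]
      comp_cfunctor[OF comp_cfunctor[OF \<Gamma>.cfunctor_axioms LL.cfunctor_axioms] adj.R.cfunctor_axioms])

text \<open>The component at \<open>X\<close> of \<open>U\<^sub>[\<^sub>n\<^sub>]\<eta>\<^sub>[\<^sub>n\<^sub>]\<Gamma>\<close>.\<close>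

abbreviation "s X \<equiv> Fa R (p X) \<cdot>\<^bsub>B\<^esub> \<eta> X"

lemma \<gamma>S_unit:
  assumes X: "X \<in> Obj B"
  shows "\<gamma>S X \<cdot>\<^bsub>B\<^esub> s X = Idn B X"
proof -
  have "\<xi> (LS X) \<cdot>\<^bsub>B\<^esub> s X = (Fa R' (Fa F (p X)) \<cdot>\<^bsub>B\<^esub> \<xi> (Fo L X)) \<cdot>\<^bsub>B\<^esub> \<eta> X"
    by (rule B.cmp_extend) (use X \<xi>_natural[of "p X"] in auto)
  also have "\<dots> = Fa R' (Fa F (p X)) \<cdot>\<^bsub>B\<^esub> \<eta>' X"
    using X by (simp add: \<xi>_unit)
  finally have "\<gamma>S X \<cdot>\<^bsub>B\<^esub> s X = \<delta> X \<cdot>\<^bsub>B\<^esub> (Fa R' (Fa F (p X)) \<cdot>\<^bsub>B\<^esub> \<eta>' X)"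
    using X by (simp add: \<gamma>S_at)
  also have "\<dots> = \<gamma>' X \<cdot>\<^bsub>B\<^esub> \<eta>' X"
    by (rule B.cmp_extend[OF \<delta>_extends]) (use X in auto)
  finally show ?thesis using X by (simp add: \<gamma>'_unit)
qed

lemma counit_s:
  assumes X: "X \<in> Obj B"
  shows "\<epsilon> (LS X) \<cdot>\<^bsub>A\<^esub> Fa L (s X) = p X"
  using adj.transpose_inverse[of "p X" X] X by simp

text \<open>By \<open>counit_s\<close>, the counit at \<open>L\<^sub>[\<^sub>n\<^sub>]\<Gamma>X\<close> is a left factor of \<open>\<pi>\<^sub>[\<^sub>n\<^sub>]\<Gamma>X\<close>, which is a composite
  of coequalizers by construction.\<close>

lemma counit_composite:
  assumes X: "X \<in> Obj B"
  shows "composite_of_regular_epis A (\<epsilon> (LS X))"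
  by (rule A.composite_left_factor[where s = "Fa L (s X)"])
    (use X coequalizers counit_s ppi_composite in auto)

text \<open>In terms of algebras for the monad \<open>R'L'\<close>, the component \<open>\<delta> X\<close> is a morphism from
  \<open>R'FL\<^sub>[\<^sub>n\<^sub>]\<Gamma>X\<close> with its canonical structure to \<open>(X, \<gamma>' X)\<close>. Both sides agree after composition with \<open>R'L'R'F\<pi>\<^sub>[\<^sub>n\<^sub>]\<Gamma>\<close>, by the multiplicativity of \<open>\<gamma>'\<close>; that arrow is epic because
  \<open>R'\<close>, \<open>F\<close> and the left adjoint \<open>L'\<close> preserve regular epimorphisms.\<close>

lemma \<delta>_algebra_morphism:
  assumes X: "X \<in> Obj B"
  shows "\<delta> X \<cdot>\<^bsub>B\<^esub> Fa R' (\<epsilon>' (Fo F (LS X))) = \<gamma>' X \<cdot>\<^bsub>B\<^esub> Fa R' (Fa F (Fa L (\<delta> X)))"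
proof -
  let ?p = "Fa R' (Fa F (p X))"
  let ?e = "Fa R' (Fa F (Fa L ?p))"
  have "composite_of_regular_epis B ?p"
    by (intro adj'.R.preserves_composites[OF R'_regular_epis]
        F.preserves_composites[OF preserves_regular_episI[OF F_coequalizers]] ppi_composite X)
  then have "composite_of_regular_epis B (Fa R' (Fa L' ?p))"
    by (rule adj'.R.preserves_composites[OF R'_regular_epis adj'.L.preserves_composites[OF
          preserves_regular_episI[OF adj'.left_adjoint_preserves_coequalizers]]])
  then have epi: "composite_of_regular_epis B ?e"
    using X by simp
  have "(\<delta> X \<cdot>\<^bsub>B\<^esub> Fa R' (\<epsilon>' (Fo F (LS X)))) \<cdot>\<^bsub>B\<^esub> ?e =
      \<delta> X \<cdot>\<^bsub>B\<^esub> Fa R' (\<epsilon>' (Fo F (LS X)) \<cdot>\<^bsub>A'\<^esub> Fa F (Fa L ?p))"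
    using X by simp
  also have "\<dots> = \<delta> X \<cdot>\<^bsub>B\<^esub> (?p \<cdot>\<^bsub>B\<^esub> Fa R' (\<epsilon>' (Fo F (Fo L X))))"
    using X counit'_natural[of "Fa F (p X)"] by simp
  also have "\<dots> = \<gamma>' X \<cdot>\<^bsub>B\<^esub> Fa R' (\<epsilon>' (Fo F (Fo L X)))"
    by (rule B.cmp_extend[OF \<delta>_extends]) (use X in auto)
  also have "\<dots> = \<gamma>' X \<cdot>\<^bsub>B\<^esub> Fa R' (Fa F (Fa L (\<delta> X \<cdot>\<^bsub>B\<^esub> ?p)))"
    using X by (simp add: \<gamma>'_mult \<delta>_extends)
  also have "\<dots> = (\<gamma>' X \<cdot>\<^bsub>B\<^esub> Fa R' (Fa F (Fa L (\<delta> X)))) \<cdot>\<^bsub>B\<^esub> ?e"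
    using X by simp
  finally show ?thesis
    by (rule B.composite_cancel[OF epi, rotated -1]) (use X in auto)
qed

text \<open>Since \<open>\<delta>\<close> is a morphism of algebras, the left-hand side equals
  \<open>\<delta> \<circ> R'\<epsilon>'F \<circ> R'L'\<xi>\<close>, and \<open>\<epsilon>'F \<circ> L'\<xi> = F\<epsilon>\<close>.\<close>

lemma \<delta>_coequalizes:
  assumes X: "X \<in> Obj B"
  shows "\<delta> X \<cdot>\<^bsub>B\<^esub> Fa R' (Fa F (p X \<cdot>\<^bsub>A\<^esub> Fa L (\<gamma>S X))) = \<delta> X \<cdot>\<^bsub>B\<^esub> Fa R' (Fa F (\<epsilon> (LS X)))"
proof -
  let ?\<xi> = "Fa R' (Fa F (Fa L (\<xi> (LS X))))"
  have "\<delta> X \<cdot>\<^bsub>B\<^esub> Fa R' (Fa F (p X \<cdot>\<^bsub>A\<^esub> Fa L (\<gamma>S X))) =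
      \<delta> X \<cdot>\<^bsub>B\<^esub> (Fa R' (Fa F (p X)) \<cdot>\<^bsub>B\<^esub> Fa R' (Fa F (Fa L (\<gamma>S X))))"
    using X by simp
  also have "\<dots> = \<gamma>' X \<cdot>\<^bsub>B\<^esub> Fa R' (Fa F (Fa L (\<gamma>S X)))"
    by (rule B.cmp_extend[OF \<delta>_extends]) (use X in auto)
  also have "\<dots> = (\<gamma>' X \<cdot>\<^bsub>B\<^esub> Fa R' (Fa F (Fa L (\<delta> X)))) \<cdot>\<^bsub>B\<^esub> ?\<xi>"
    using X by (simp add: \<gamma>S_at)
  also have "\<dots> = (\<delta> X \<cdot>\<^bsub>B\<^esub> Fa R' (\<epsilon>' (Fo F (LS X)))) \<cdot>\<^bsub>B\<^esub> ?\<xi>"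
    using X by (simp only: \<delta>_algebra_morphism)
  also have "\<dots> = \<delta> X \<cdot>\<^bsub>B\<^esub> Fa R' (\<epsilon>' (Fo F (LS X)) \<cdot>\<^bsub>A'\<^esub> Fa F (Fa L (\<xi> (LS X))))"
    using X by simp
  finally show ?thesis
    using X by (simp only: counit'_\<xi> \<Gamma>.fo_in LL.fo_in)
qed

abbreviation "NS \<equiv> next_stage B A L R \<epsilon> q S"
abbreviation "N\<Gamma> \<equiv> pair_fctr B \<Gamma> \<gamma>S"

lemma N\<Gamma>_obj [simp]: "X \<in> Obj B \<Longrightarrow> OPair (Fo \<Gamma> X) (\<gamma>S X) \<in> next_obj B R S"
  by (simp add: next_obj_def)

lemma N\<Gamma>_cfunctor: "cfunctor B NB N\<Gamma>"
proof (rule cfunctorI)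
  fix f
  assume f: "f \<in> Arr B"
  show "Fa N\<Gamma> f \<in> Arr NB \<and> Dom NB (Fa N\<Gamma> f) = Fo N\<Gamma> (Dom B f) \<and>
      Cod NB (Fa N\<Gamma> f) = Fo N\<Gamma> (Cod B f)"
    using f \<gamma>S_natural[OF f] by (auto intro!: next_arrI)
qed (auto simp: B.category_axioms next_category)

text \<open>The two parallel arrows of \<open>A\<close> that define \<open>L\<^sub>[\<^sub>n\<^sub>+\<^sub>1\<^sub>]\<close> at \<open>(\<Gamma>X, \<gamma>\<^sub>[\<^sub>n\<^sub>]X)\<close> differ by the idempotent
  \<open>L(s \<circ> \<gamma>\<^sub>[\<^sub>n\<^sub>])\<close> on \<open>LRL\<^sub>[\<^sub>n\<^sub>]\<Gamma>X\<close>, so their images in \<open>A'\<close> are a pair that \<open>R'\<close> treats well.\<close>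

lemma R'F\<pi>_coequalizer:
  assumes X: "X \<in> Obj B"
  shows "is_coequalizer B (Fa R' (Fa F (p X \<cdot>\<^bsub>A\<^esub> Fa L (\<gamma>S X)))) (Fa R' (Fa F (\<epsilon> (LS X))))
    (Fa R' (Fa F (\<pi> (Fo N\<Gamma> X))))"
proof -
  let ?f = "Fa F (\<epsilon> (LS X))" and ?e = "Fa F (Fa L (s X \<cdot>\<^bsub>B\<^esub> \<gamma>S X))"
  have "\<epsilon> (LS X) \<cdot>\<^bsub>A\<^esub> (Fa L (s X) \<cdot>\<^bsub>A\<^esub> Fa L (\<gamma>S X)) = p X \<cdot>\<^bsub>A\<^esub> Fa L (\<gamma>S X)"
    by (rule A.cmp_extend[OF counit_s]) (use X in auto)
  then have eq: "\<epsilon> (LS X) \<cdot>\<^bsub>A\<^esub> Fa L (s X \<cdot>\<^bsub>B\<^esub> \<gamma>S X) = p X \<cdot>\<^bsub>A\<^esub> Fa L (\<gamma>S X)"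
    using X by simp
  have "Fa F (\<epsilon> (LS X) \<cdot>\<^bsub>A\<^esub> Fa L (s X \<cdot>\<^bsub>B\<^esub> \<gamma>S X)) = ?f \<cdot>\<^bsub>A'\<^esub> ?e"
    using X by simp
  then have fe: "Fa F (p X \<cdot>\<^bsub>A\<^esub> Fa L (\<gamma>S X)) = ?f \<cdot>\<^bsub>A'\<^esub> ?e"
    by (simp only: eq)
  have "\<gamma>S X \<cdot>\<^bsub>B\<^esub> (s X \<cdot>\<^bsub>B\<^esub> \<gamma>S X) = Idn B X \<cdot>\<^bsub>B\<^esub> \<gamma>S X"
    by (rule B.cmp_extend[OF \<gamma>S_unit]) (use X in auto)
  then have "(s X \<cdot>\<^bsub>B\<^esub> \<gamma>S X) \<cdot>\<^bsub>B\<^esub> (s X \<cdot>\<^bsub>B\<^esub> \<gamma>S X) = s X \<cdot>\<^bsub>B\<^esub> \<gamma>S X"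
    using X by simp
  then have "Fa F (Fa L ((s X \<cdot>\<^bsub>B\<^esub> \<gamma>S X) \<cdot>\<^bsub>B\<^esub> (s X \<cdot>\<^bsub>B\<^esub> \<gamma>S X))) = ?e"
    by simp
  then have idem: "idempotent A' ?e"
    using X by (simp add: idempotent_def)
  have "is_coequalizer A (p X \<cdot>\<^bsub>A\<^esub> Fa L (\<gamma>S X)) (\<epsilon> (LS X)) (\<pi> (Fo N\<Gamma> X))"
    using \<pi>_coequalizer[of "Fo N\<Gamma> X"] X by simp
  then have "is_coequalizer A' (Fa F (p X \<cdot>\<^bsub>A\<^esub> Fa L (\<gamma>S X))) ?f (Fa F (\<pi> (Fo N\<Gamma> X)))"
    using F_coequalizers unfolding preserves_coequalizers_def by blast
  moreover have "composite_of_regular_epis A' ?f"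
    by (intro F.preserves_composites[OF preserves_regular_episI[OF F_coequalizers]]
        counit_composite X)
  moreover have "Cod A' ?e = Dom A' ?f"
    using X by simp
  ultimately show ?thesis
    using R'_twisted idem unfolding preserves_idempotent_twisted_coequalizers_def fe by auto
qed

lemma next_lift_exists:
  "\<exists>\<delta>'. \<forall>X \<in> Obj B. \<delta>' X \<in> Arr B \<and> Dom B (\<delta>' X) = Fo R' (Fo F (Fo NL (Fo N\<Gamma> X))) \<and>
     Cod B (\<delta>' X) = X \<and> \<delta>' X \<cdot>\<^bsub>B\<^esub> Fa R' (Fa F (\<pi> (Fo N\<Gamma> X))) = \<delta> X"
proof (rule bchoice, intro ballI)
  fix X
  assume X: "X \<in> Obj B"
  obtain k where "k \<in> Arr B" "Dom B k = Cod B (Fa R' (Fa F (\<pi> (Fo N\<Gamma> X))))"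
      "Cod B k = Cod B (\<delta> X)" "k \<cdot>\<^bsub>B\<^esub> Fa R' (Fa F (\<pi> (Fo N\<Gamma> X))) = \<delta> X"
    by (rule coequalizer_factor[OF R'F\<pi>_coequalizer[OF X] _ _ \<delta>_coequalizes[OF X]]) (use X in auto)
  then show "\<exists>k. k \<in> Arr B \<and> Dom B k = Fo R' (Fo F (Fo NL (Fo N\<Gamma> X))) \<and> Cod B k = X \<and>
      k \<cdot>\<^bsub>B\<^esub> Fa R' (Fa F (\<pi> (Fo N\<Gamma> X))) = \<delta> X"
    using X by auto
qed

lemma next_lifted_augmentation:
  "\<exists>\<delta>'. lifted_augmentation B A A' L R \<eta> \<epsilon> L' R' \<eta>' \<epsilon>' F \<xi> \<gamma>' q NS N\<Gamma> \<delta>' \<and>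
     (\<forall>X \<in> Obj B. stage_augmentation B \<xi> NS N\<Gamma> \<delta>' X \<cdot>\<^bsub>B\<^esub> Fa R (\<pi> (Fo N\<Gamma> X)) = \<gamma>S X)"
proof -
  have NS [simp]: "BB NS = NB" "UU NS = UU S \<circ>\<^sub>F forget" "LL NS = NL"
      "ppi NS = vcomp A \<pi> (ppi S \<lhd> forget)"
    by (simp_all add: next_stage_def)
  interpret NL: cfunctor NB A NL by (rule next_L_cfunctor)
  interpret N\<Gamma>: cfunctor B NB N\<Gamma> by (rule N\<Gamma>_cfunctor)
  obtain \<delta>' where \<delta>'_arr [simp]: "\<And>X. X \<in> Obj B \<Longrightarrow> \<delta>' X \<in> Arr B"
      "\<And>X. X \<in> Obj B \<Longrightarrow> Dom B (\<delta>' X) = Fo R' (Fo F (Fo NL (OPair (Fo \<Gamma> X) (\<gamma>S X))))"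
      "\<And>X. X \<in> Obj B \<Longrightarrow> Cod B (\<delta>' X) = X"
    and \<delta>'_\<pi>: "\<And>X. X \<in> Obj B \<Longrightarrow> \<delta>' X \<cdot>\<^bsub>B\<^esub> Fa R' (Fa F (\<pi> (OPair (Fo \<Gamma> X) (\<gamma>S X)))) = \<delta> X"
    using next_lift_exists by auto
  have NL_N\<Gamma> [simp]: "X \<in> Obj B \<Longrightarrow> Fo NL (OPair (Fo \<Gamma> X) (\<gamma>S X)) \<in> Obj A" for X
    using NL.fo_in[of "Fo N\<Gamma> X"] by simp
  have natural: "\<delta>' (Cod B f) \<cdot>\<^bsub>B\<^esub> Fa R' (Fa F (Fa NL (Fa N\<Gamma> f))) = f \<cdot>\<^bsub>B\<^esub> \<delta>' (Dom B f)"
    if f: "f \<in> Arr B" for f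
  proof -
    let ?X = "Dom B f" and ?Y = "Cod B f"
    let ?\<pi>X = "\<pi> (Fo N\<Gamma> ?X)" and ?\<pi>Y = "\<pi> (Fo N\<Gamma> ?Y)" and ?g = "Fa (LL S) (Fa \<Gamma> f)"
    have Nf: "Fa N\<Gamma> f \<in> Arr NB"
      using N\<Gamma>.fa_arr(1)[OF f] .
    note NLf = NL_arr[OF Nf]
    have "(\<delta>' ?Y \<cdot>\<^bsub>B\<^esub> Fa R' (Fa F (Fa NL (Fa N\<Gamma> f)))) \<cdot>\<^bsub>B\<^esub> Fa R' (Fa F ?\<pi>X) =
        \<delta>' ?Y \<cdot>\<^bsub>B\<^esub> Fa R' (Fa F (Fa NL (Fa N\<Gamma> f) \<cdot>\<^bsub>A\<^esub> ?\<pi>X))"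
      using f NLf(1-3) by simp
    also have "\<dots> = \<delta>' ?Y \<cdot>\<^bsub>B\<^esub> (Fa R' (Fa F ?\<pi>Y) \<cdot>\<^bsub>B\<^esub> Fa R' (Fa F ?g))"
      using f NLf(4) by simp
    also have "\<dots> = \<delta> ?Y \<cdot>\<^bsub>B\<^esub> Fa R' (Fa F ?g)"
      by (rule B.cmp_extend) (use f \<delta>'_\<pi> in auto)
    also have "\<dots> = (f \<cdot>\<^bsub>B\<^esub> \<delta>' ?X) \<cdot>\<^bsub>B\<^esub> Fa R' (Fa F ?\<pi>X)"
      using f \<delta>_natural[OF f] \<delta>'_\<pi>[of ?X] by simp
    finally show ?thesis
      by (rule B.coequalizer_epi[OF R'F\<pi>_coequalizer, rotated -1]) (use f NLf(1-3) in auto)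
  qed
  have nat: "nat_trans B B (R' \<circ>\<^sub>F F \<circ>\<^sub>F NL \<circ>\<^sub>F N\<Gamma>) id_fctr \<delta>'"
  proof (rule nat_transI)
    show "cfunctor B B (R' \<circ>\<^sub>F F \<circ>\<^sub>F NL \<circ>\<^sub>F N\<Gamma>)"
      by (intro comp_cfunctor[of _ A'] comp_cfunctor[of _ A] comp_cfunctor[of _ NB]
          adj'.R.cfunctor_axioms F.cfunctor_axioms NL.cfunctor_axioms N\<Gamma>.cfunctor_axioms)
  qed (use natural in \<open>auto simp: id_cfunctor[OF B.category_axioms]\<close>)
  have extends: "\<delta>' X \<cdot>\<^bsub>B\<^esub> Fa R' (Fa F (ppi NS (Fo N\<Gamma> X))) = \<gamma>' X" if X: "X \<in> Obj B" for X
  proof -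
    have "\<delta>' X \<cdot>\<^bsub>B\<^esub> (Fa R' (Fa F (\<pi> (Fo N\<Gamma> X))) \<cdot>\<^bsub>B\<^esub> Fa R' (Fa F (p X))) = \<delta> X \<cdot>\<^bsub>B\<^esub> Fa R' (Fa F (p X))"
      by (rule B.cmp_extend) (use X \<delta>'_\<pi> in auto)
    then show ?thesis
      using X by (simp add: whisker_defs forget_def \<delta>_extends)
  qed
  have composite: "composite_of_regular_epis A (ppi NS (Fo N\<Gamma> X))" if X: "X \<in> Obj B" for X
  proof -
    have "regular_epi A (\<pi> (Fo N\<Gamma> X))"
      using \<pi>_coequalizer[of "Fo N\<Gamma> X"] X unfolding regular_epi_def by auto
    then show ?thesis
      using composite_of_regular_epis.compose[OF ppi_composite[OF X], of "\<pi> (Fo N\<Gamma> X)"] X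
      by (simp add: whisker_defs forget_def)
  qed
  have "stage_augmentation B \<xi> NS N\<Gamma> \<delta>' X \<cdot>\<^bsub>B\<^esub> Fa R (\<pi> (Fo N\<Gamma> X)) = \<gamma>S X" if X: "X \<in> Obj B" for X
  proof -
    have at: "stage_augmentation B \<xi> NS N\<Gamma> \<delta>' X = \<delta>' X \<cdot>\<^bsub>B\<^esub> \<xi> (Fo NL (Fo N\<Gamma> X))"
      by (simp add: stage_augmentation_def whisker_defs)
    have "stage_augmentation B \<xi> NS N\<Gamma> \<delta>' X \<cdot>\<^bsub>B\<^esub> Fa R (\<pi> (Fo N\<Gamma> X)) =
        \<delta>' X \<cdot>\<^bsub>B\<^esub> (Fa R' (Fa F (\<pi> (Fo N\<Gamma> X))) \<cdot>\<^bsub>B\<^esub> \<xi> (LS X))"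
      using X \<xi>_natural[of "\<pi> (Fo N\<Gamma> X)"] by (simp add: at)
    also have "\<dots> = \<delta> X \<cdot>\<^bsub>B\<^esub> \<xi> (LS X)"
      by (rule B.cmp_extend) (use X \<delta>'_\<pi> in auto)
    also have "\<dots> = \<gamma>S X"
      by (rule \<gamma>S_at[symmetric])
    finally show ?thesis .
  qed
  moreover have "lifted_augmentation B A A' L R \<eta> \<epsilon> L' R' \<eta>' \<epsilon>' F \<xi> \<gamma>' q NS N\<Gamma> \<delta>'"
    unfolding lifted_augmentation_def lifted_augmentation_axioms_def decomposition_step_def
      decomposition_step_axioms_def
    using nat extends composite augmented_comparison_axioms next_decomposition_stage choice
      N\<Gamma>_cfunctor
    by (auto simp: forget_def)
  ultimately show ?thesis by blast
qed

end

lemma (in augmented_comparison) base_lifted_augmentation: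
  assumes "coequalizer_choice A q"
  shows "lifted_augmentation B A A' L R \<eta> \<epsilon> L' R' \<eta>' \<epsilon>' F \<xi> \<gamma>' q
    (base_stage B A L R \<eta> \<epsilon>) wrap_fctr \<gamma>'"
proof -
  let ?S = "base_stage B A L R \<eta> \<epsilon>"
  have S [simp]: "BB ?S = base_cat B" "UU ?S = unwrap_fctr" "LL ?S = L \<circ>\<^sub>F unwrap_fctr"
      "ppi ?S = id_nat A (L \<circ>\<^sub>F unwrap_fctr)"
    by (simp_all add: base_stage_def)
  have wrap: "cfunctor B (base_cat B) wrap_fctr"
    by (rule cfunctorI[OF B.category_axioms B.base_category]) auto
  have unwrap: "cfunctor (base_cat B) B unwrap_fctr"
    by (rule cfunctorI[OF B.base_category B.category_axioms]) auto
  have "nat_trans B B (R' \<circ>\<^sub>F F \<circ>\<^sub>F (L \<circ>\<^sub>F unwrap_fctr) \<circ>\<^sub>F wrap_fctr) id_fctr \<gamma>'"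
  proof (rule nat_transI)
    show "cfunctor B B (R' \<circ>\<^sub>F F \<circ>\<^sub>F (L \<circ>\<^sub>F unwrap_fctr) \<circ>\<^sub>F wrap_fctr)"
      by (intro comp_cfunctor[of _ A'] comp_cfunctor[of _ A] comp_cfunctor[of _ "base_cat B"]
          comp_cfunctor[of _ B] adj'.R.cfunctor_axioms F.cfunctor_axioms adj.L.cfunctor_axioms
          wrap unwrap)
    show "\<gamma>' (Cod B f) \<cdot>\<^bsub>B\<^esub> Fa (R' \<circ>\<^sub>F F \<circ>\<^sub>F (L \<circ>\<^sub>F unwrap_fctr) \<circ>\<^sub>F wrap_fctr) f =
        Fa id_fctr f \<cdot>\<^bsub>B\<^esub> \<gamma>' (Dom B f)" if "f \<in> Arr B" for f
      using aug'.nat.natural[OF that refl refl] that by simp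
  qed (auto simp: id_cfunctor[OF B.category_axioms])
  moreover have "composite_of_regular_epis A (Idn A (Fo L X))" if "X \<in> Obj B" for X
    using that by (intro composite_of_regular_epis.single A.idn_regular_epi) simp
  ultimately show ?thesis
    unfolding lifted_augmentation_def lifted_augmentation_axioms_def decomposition_step_def
      decomposition_step_axioms_def
    using wrap assms augmented_comparison_axioms adj.base_decomposition_stage
    by (auto simp: id_nat_def)
qed

text \<open>The next \<open>\<delta>\<close> is only known to exist, so the sequence is obtained by dependent choice.\<close>

lemma (in augmented_comparison) lifted_augmentation_sequence:
  assumes "coequalizer_choice A q"
  obtains \<Gamma> \<delta> where "\<Gamma> 0 = wrap_fctr" "\<delta> 0 = \<gamma>'"
    "\<And>n. lifted_augmentation B A A' L R \<eta> \<epsilon> L' R' \<eta>' \<epsilon>' F \<xi> \<gamma>' q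
      (decomp B A L R \<eta> \<epsilon> q n) (\<Gamma> n) (\<delta> n)"
    "\<And>n. \<Gamma> (Suc n) =
      pair_fctr B (\<Gamma> n) (stage_augmentation B \<xi> (decomp B A L R \<eta> \<epsilon> q n) (\<Gamma> n) (\<delta> n))"
    "\<And>n X. X \<in> Obj B \<Longrightarrow>
      stage_augmentation B \<xi> (decomp B A L R \<eta> \<epsilon> q (Suc n)) (\<Gamma> (Suc n)) (\<delta> (Suc n)) X \<cdot>\<^bsub>B\<^esub>
        Fa R (decomp_pi B A L R \<eta> \<epsilon> q n (Fo (\<Gamma> (Suc n)) X)) =
      stage_augmentation B \<xi> (decomp B A L R \<eta> \<epsilon> q n) (\<Gamma> n) (\<delta> n) X"
proof -
  let ?D = "decomp B A L R \<eta> \<epsilon> q"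
  let ?P = "\<lambda>n x. lifted_augmentation B A A' L R \<eta> \<epsilon> L' R' \<eta>' \<epsilon>' F \<xi> \<gamma>' q (?D n) (fst x) (snd x) \<and>
    (n = 0 \<longrightarrow> x = (wrap_fctr, \<gamma>'))"
  let ?g = "\<lambda>n x. stage_augmentation B \<xi> (?D n) (fst x) (snd x)"
  let ?Q = "\<lambda>n x y. fst y = pair_fctr B (fst x) (?g n x) \<and>
    (\<forall>X \<in> Obj B. ?g (Suc n) y X \<cdot>\<^bsub>B\<^esub> Fa R (decomp_pi B A L R \<eta> \<epsilon> q n (Fo (fst y) X)) = ?g n x X)"
  have "\<exists>h. \<forall>n. ?P n (h n) \<and> ?Q n (h n) (h (Suc n))"
  proof (rule dependent_nat_choice)
    show "\<exists>x. ?P 0 x"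
      using base_lifted_augmentation[OF assms] by (intro exI[of _ "(wrap_fctr, \<gamma>')"]) simp
    fix x n
    assume "?P n x"
    then interpret stage: lifted_augmentation B A A' L R \<eta> \<epsilon> L' R' \<eta>' \<epsilon>' F \<xi> \<gamma>' q "?D n" "fst x" "snd x"
      by blast
    obtain \<delta>' where "?P (Suc n) (pair_fctr B (fst x) (?g n x), \<delta>')"
        "?Q n x (pair_fctr B (fst x) (?g n x), \<delta>')"
      using stage.next_lifted_augmentation by (auto simp: decomp_pi_def)
    then show "\<exists>y. ?P (Suc n) y \<and> ?Q n x y" by blast
  qed
  then obtain h where h: "\<And>n. ?P n (h n)" "\<And>n. ?Q n (h n) (h (Suc n))"
    by blast
  have h0: "h 0 = (wrap_fctr, \<gamma>')"
    using h(1)[of 0] by blast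
  show thesis
  proof (rule that[of "\<lambda>n. fst (h n)" "\<lambda>n. snd (h n)"])
    show "fst (h 0) = wrap_fctr" "snd (h 0) = \<gamma>'"
      by (simp_all add: h0)
  qed (use conjunct1[OF h(1)] conjunct1[OF h(2)] bspec[OF conjunct2[OF h(2)]] in blast)+
qed

theorem theorem5p1:
  fixes B :: "('b, 'f) cat" and A :: "('a, 'g) cat" and A' :: "('c, 'h) cat"
    and L :: "('b, 'f, 'a, 'g) fctr" and R :: "('a, 'g, 'b, 'f) fctr"
    and \<eta> :: "'b \<Rightarrow> 'f" and \<epsilon> :: "'a \<Rightarrow> 'g"
    and L' :: "('b, 'f, 'c, 'h) fctr" and R' :: "('c, 'h, 'b, 'f) fctr"
    and \<eta>' :: "'b \<Rightarrow> 'f" and \<epsilon>' :: "'c \<Rightarrow> 'h"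
    and F :: "('a, 'g, 'c, 'h) fctr"
    and \<xi> :: "'a \<Rightarrow> 'f"
  assumes adj: "adjunction B A L R \<eta> \<epsilon>"
    and adj': "adjunction B A' L' R' \<eta>' \<epsilon>'"
    and F: "cfunctor A A' F"
    and FL: "fctr_eq B (F \<circ>\<^sub>F L) L'"
    and \<xi>: "\<xi> = comparison B R \<epsilon> R' \<eta>' F"
  shows
    "nat_trans A B R (R' \<circ>\<^sub>F F) \<xi> \<and>
     monad_morphism B
       (R \<circ>\<^sub>F L) (R \<rhd> (\<epsilon> \<lhd> L)) \<eta>
       (R' \<circ>\<^sub>F L') (R' \<rhd> (\<epsilon>' \<lhd> L')) \<eta>'
       (\<xi> \<lhd> L) \<and>
     nat_eq A (vcomp A' (\<epsilon>' \<lhd> F) (L' \<rhd> \<xi>)) (F \<rhd> \<epsilon>) \<and>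
     (\<forall>\<gamma>' \<gamma>.
        has_coequalizers A \<and> preserves_coequalizers A A' F \<and>
        preserves_idempotent_twisted_coequalizers A' B R' \<and>
        preserves_regular_epis A' B R' \<and>
        augmentation B (R' \<circ>\<^sub>F L') (R' \<rhd> (\<epsilon>' \<lhd> L')) \<eta>' \<gamma>' \<and>
        \<gamma> = vcomp B \<gamma>' (\<xi> \<lhd> L) \<longrightarrow>
          augmentation B (R \<circ>\<^sub>F L) (R \<rhd> (\<epsilon> \<lhd> L)) \<eta> \<gamma> \<and>
          (\<forall>q D. coequalizer_choice A q \<and> D = decomp B A L R \<eta> \<epsilon> q \<longrightarrow>
            (\<exists>\<Gamma> \<gamma>\<^sub>n.
              (\<forall>n. cfunctor B (BB (D n)) (\<Gamma> n)) \<and>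
              (\<forall>n. nat_trans B B (R \<circ>\<^sub>F LL (D n) \<circ>\<^sub>F \<Gamma> n) id_fctr (\<gamma>\<^sub>n n)) \<and>
              fctr_eq B (\<Gamma> 0) wrap_fctr \<and>
              nat_eq B (\<gamma>\<^sub>n 0) \<gamma> \<and>
              (\<forall>n. \<forall>X \<in> Obj B.
                 Fo (\<Gamma> (Suc n)) X = OPair (Fo (\<Gamma> n) X) (\<gamma>\<^sub>n n X) \<and>
                 OPair (Fo (\<Gamma> n) X) (\<gamma>\<^sub>n n X) \<in> Obj (BB (D (Suc n)))) \<and>
              (\<forall>n. nat_eq B
                 (vcomp B (\<gamma>\<^sub>n n) ((UU (D n) \<rhd> unitt (D n)) \<lhd> \<Gamma> n)) (id_nat B id_fctr)) \<and>
              (\<forall>n. nat_eq B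
                 (vcomp B (\<gamma>\<^sub>n (Suc n)) ((R \<rhd> decomp_pi B A L R \<eta> \<epsilon> q n) \<lhd> \<Gamma> (Suc n)))
                 (\<gamma>\<^sub>n n)) \<and>
              (\<forall>n. fctr_eq B (forget \<circ>\<^sub>F \<Gamma> (Suc n)) (\<Gamma> n)))))"
proof -
  interpret adj: adjunction B A L R \<eta> \<epsilon> by fact
  interpret adj': adjunction B A' L' R' \<eta>' \<epsilon>' by fact
  interpret F: cfunctor A A' F by fact
  interpret comparison_of_adjunctions B A A' L R \<eta> \<epsilon> L' R' \<eta>' \<epsilon>' F \<xi>
    by unfold_locales (rule FL, rule \<xi>)
  have counit: "nat_eq A (vcomp A' (\<epsilon>' \<lhd> F) (L' \<rhd> \<xi>)) (F \<rhd> \<epsilon>)"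
    by (auto simp: whisker_defs counit'_\<xi>)
  show ?thesis
  proof (intro conjI allI impI \<xi>_nat_trans \<xi>L_monad_morphism counit, goal_cases)
    case (1 \<gamma>' \<gamma>)
    then have "augmentation B (R' \<circ>\<^sub>F L') (R' \<rhd> (\<epsilon>' \<lhd> L')) \<eta>' \<gamma>'"
        and \<gamma>: "\<gamma> = vcomp B \<gamma>' (\<xi> \<lhd> L)"
      by simp_all
    then show ?case
      unfolding \<gamma> by (intro monad_morphism_pulls_back_augmentation[OF \<xi>L_monad_morphism])
  next
    case (2 \<gamma>' \<gamma> q D)
    then interpret augmented_comparison B A A' L R \<eta> \<epsilon> L' R' \<eta>' \<epsilon>' F \<xi> \<gamma>'
      by (intro augmented_comparison.intro augmented_comparison_axioms.intro
          comparison_of_adjunctions_axioms) simp_all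
    have D: "D = decomp B A L R \<eta> \<epsilon> q" and q: "coequalizer_choice A q"
        and \<gamma>: "\<gamma> = vcomp B \<gamma>' (\<xi> \<lhd> L)"
      using 2 by simp_all
    show ?case
    proof (rule lifted_augmentation_sequence[OF q, folded D])
      fix \<Gamma> \<delta>
      assume base: "\<Gamma> 0 = wrap_fctr" "\<delta> 0 = \<gamma>'"
        and lifted: "\<And>n. lifted_augmentation B A A' L R \<eta> \<epsilon> L' R' \<eta>' \<epsilon>' F \<xi> \<gamma>' q (D n) (\<Gamma> n) (\<delta> n)"
        and Suc: "\<And>n. \<Gamma> (Suc n) = pair_fctr B (\<Gamma> n) (stage_augmentation B \<xi> (D n) (\<Gamma> n) (\<delta> n))"
        and extends: "\<And>n X. X \<in> Obj B \<Longrightarrow>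
          stage_augmentation B \<xi> (D (Suc n)) (\<Gamma> (Suc n)) (\<delta> (Suc n)) X \<cdot>\<^bsub>B\<^esub>
          Fa R (decomp_pi B A L R \<eta> \<epsilon> q n (Fo (\<Gamma> (Suc n)) X)) =
        stage_augmentation B \<xi> (D n) (\<Gamma> n) (\<delta> n) X"
      let ?g = "\<lambda>n. stage_augmentation B \<xi> (D n) (\<Gamma> n) (\<delta> n)"
      show ?case
      proof (intro exI[of _ \<Gamma>] exI[of _ ?g] conjI allI ballI)
        fix n X
        interpret stage: lifted_augmentation B A A' L R \<eta> \<epsilon> L' R' \<eta>' \<epsilon>' F \<xi> \<gamma>' q "D n" "\<Gamma> n" "\<delta> n"
          by (rule lifted)
        show "cfunctor B (BB (D n)) (\<Gamma> n)"
          by (rule stage.\<Gamma>.cfunctor_axioms)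
        show "nat_trans B B (R \<circ>\<^sub>F LL (D n) \<circ>\<^sub>F \<Gamma> n) id_fctr (?g n)"
          by (rule stage.\<gamma>S_nat_trans)
        show "Fo (\<Gamma> (Suc n)) X = OPair (Fo (\<Gamma> n) X) (?g n X)"
          by (simp add: Suc)
        show "OPair (Fo (\<Gamma> n) X) (?g n X) \<in> Obj (BB (D (Suc n)))" if "X \<in> Obj B"
          using stage.N\<Gamma>_obj[OF that] by (simp add: D next_stage_def next_cat_def)
        show "nat_eq B (vcomp B (?g n) ((UU (D n) \<rhd> unitt (D n)) \<lhd> \<Gamma> n)) (id_nat B id_fctr)"
          using stage.\<gamma>S_unit by (simp add: whisker_defs stage.underlying_unit)
        show "nat_eq B (vcomp B (?g (Suc n)) ((R \<rhd> decomp_pi B A L R \<eta> \<epsilon> q n) \<lhd> \<Gamma> (Suc n))) (?g n)"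
          using extends by (simp add: whisker_defs)
        show "fctr_eq B (forget \<circ>\<^sub>F \<Gamma> (Suc n)) (\<Gamma> n)"
          by (simp add: fctr_eq_def Suc forget_def)
      next
        show "fctr_eq B (\<Gamma> 0) wrap_fctr"
          by (simp add: fctr_eq_def base)
        show "nat_eq B (?g 0) \<gamma>"
          by (simp add: \<gamma> base D base_stage_def stage_augmentation_def whisker_defs)
      qed
    qed
  qed
qed

end
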